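(* Let $n\ge 1$, $m\ge 0$, $d\ge 0$, $\tilde d\ge 0$ be integers, let $\epsilon_+,\epsilon_-,\tilde\epsilon_+,\tilde\epsilon_-\in\{0,1\}$, and let $a_1,\ldots,a_d$ and $\tilde a_1,\ldots,\tilde a_{\tilde d}$ be complex parameters with $|a_r|<1$ ($r=1,\ldots,d$) and $|\tilde a_r|<1$ ($r=1,\ldots,\tilde d$), where in each of the two families the non-real parameters arise in complex conjugate pairs. Put $d_\epsilon:=\frac12(d-\epsilon_+-\epsilon_-)$ and $\tilde d_{\tilde\epsilon}:=\frac12(\tilde d-\tilde\epsilon_+-\tilde\epsilon_-)$, and assume $$m+n-1>\lceil d_\epsilon\rceil+\lceil\tilde d_{\tilde\epsilon}\rceil .$$ Then $$\frac{1}{(2\pi)^n\,n!}\int_0^\pi\cdots\int_0^\pi R(\boldsymbol{\xi})\,\rho_\epsilon(\boldsymbol{\xi})\,\mathrm{d}\xi_1\cdots\mathrm{d}\xi_n=\sum_{\lambda\in\Lambda^{(m,n)}}R\bigl(\boldsymbol{\xi}^{(m,n)}_\lambda\bigr)\,\rho_\epsilon\bigl(\boldsymbol{\xi}^{(m,n)}_\lambda\bigr)\,\Delta^{(m,n)}_\lambda$$ for every function $R$ of the form $$R(\boldsymbol{\xi})=\frac{f\bigl(\cos(\xi_1),\ldots,\cos(\xi_n)\bigr)}{\prod_{1\le r\le d,\;1\le j\le n}\bigl(1-2a_r\cos(\xi_j)+a_r^2\bigr)},$$ where $f(x_1,\ldots,x_n)$ is an arbitrary symmetric polynomial in $\mathbb{P}^{(D,n)}$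 with $$D=2m+\tilde\epsilon_++\tilde\epsilon_--\tilde d-1 .$$ Here the density $\rho_\epsilon(\boldsymbol{\xi})$, the index set $\Lambda^{(m,n)}$, the nodes $\boldsymbol{\xi}^{(m,n)}_\lambda$ and the weights $\Delta^{(m,n)}_\lambda$ are those defined in the context.
   Context: Notation, with $n,m,d,\tilde d,\epsilon_\pm,\tilde\epsilon_\pm,a_r,\tilde a_r,d_\epsilon,\tilde d_{\tilde\epsilon}$ as in the claim. Empty sums are $0$ and empty products are $1$; conjugate pairs are counted with multiplicity. Density (unnormalized unitary Jacobi ensemble): for $\boldsymbol{\xi}=(\xi_1,\ldots,\xi_n)\in[0,\pi]^n$, $$\rho_\epsilon(\boldsymbol{\xi}):=\prod_{1\le j\le n}2^{\epsilon_++\epsilon_-}\bigl(1+\epsilon_+\cos(\xi_j)\bigr)\bigl(1-\epsilon_-\cos(\xi_j)\bigr)\prod_{1\le j<k\le n}\bigl(\cos(\xi_j)-\cos(\xi_k)\bigr)^2 .$$ Polynomial space: $\mathbb{P}^{(D,n)}$ is the space of symmetric polynomials in $x_1,\ldots,x_n$ that are of degree at most $D$ in each of the variables $x_j$ (it is $\{0\}$ if $D<0$). Index set: $\Lambda^{(m,n)}:=\{\lambda=(\lambda_1,\ldots,\lambda_n)\in\mathbb{Z}^n\mid m\ge\lambda_1\ge\lambda_2\ge\cdots\ge\lambda_n\ge0\}$. One-variable nodes: for $|a|<1$ and $\theta\in\mathbb{R}$ let $$u_a(\theta):=\frac{1-a^2}{1-2a\cos(\theta)+a^2}.$$ For $l\in\{0,\ldots,m+n-1\}$,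 $\xi^{(m+n)}_l$ denotes the unique real solution $\xi$ of the equation $$2\bigl(m+n-1-d_\epsilon-\tilde d_{\tilde\epsilon}\bigr)\xi+\sum_{1\le r\le d}\int_0^\xi u_{a_r}(\theta)\,\mathrm{d}\theta+\sum_{1\le r\le\tilde d}\int_0^\xi u_{\tilde a_r}(\theta)\,\mathrm{d}\theta=\pi(2l+\epsilon_-+\tilde\epsilon_-).$$ These satisfy $0\le\xi^{(m+n)}_0<\xi^{(m+n)}_1<\cdots<\xi^{(m+n)}_{m+n-1}\le\pi$. One-variable weights: with $\delta_k:=1$ if $k=0$ and $\delta_k:=0$ otherwise, for $l\in\{0,\ldots,m+n-1\}$, $$\Delta^{(m+n)}_l:=\Bigl(\tfrac12\Bigr)^{(1-\epsilon_-)(1-\tilde\epsilon_-)\delta_l+(1-\epsilon_+)(1-\tilde\epsilon_+)\delta_{m+n-1-l}}\Biggl(2\bigl(m+n-1-d_\epsilon-\tilde d_{\tilde\epsilon}\bigr)+\sum_{1\le r\le d}u_{a_r}\bigl(\xi^{(m+n)}_l\bigr)+\sum_{1\le r\le\tilde d}u_{\tilde a_r}\bigl(\xi^{(m+n)}_l\bigr)\Biggr)^{-1}.$$ Multivariate nodes and weights: for $\lambda\in\Lambda^{(m,n)}$, $$\boldsymbol{\xi}^{(m,n)}_\lambda:=\Bigl(\xi^{(m+n)}_{\lambda_1+n-1},\,\xi^{(m+n)}_{\lambda_2+n-2},\ldots,\xi^{(m+n)}_{\lambda_{n-1}+1},\,\xi^{(m+n)}_{\lambda_n}\Bigr),\qquad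 \Delta^{(m,n)}_\lambda:=\prod_{1\le j\le n}\Delta^{(m+n)}_{\lambda_j+n-j}.$$ *)

theory Defs
  imports "HOL-Analysis.Analysis" "HOL-Library.Poly_Mapping"
begin

text \<open>
  Finite families indexed by \<open>1, \<dots>, n\<close> are functions on \<^typ>\<open>nat\<close> restricted to \<open>{1..n}\<close>.
  Parameters are grouped as \<open>ep em d a\<close> (for \<open>\<epsilon>\<^sub>+\<close>, \<open>\<epsilon>\<^sub>-\<close>, \<open>d\<close>, \<open>a\<close>) and
  \<open>tp tm d' a'\<close> (their counterparts with a tilde).
\<close>

definition conjugate_pairs :: "nat \<Rightarrow> (nat \<Rightarrow> complex) \<Rightarrow> bool" where
  "conjugate_pairs d a \<longleftrightarrow>
     (\<forall>z. z \<notin> \<real> \<longrightarrow> card {r \<in> {1..d}. a r = z} = card {r \<in> {1..d}. a r = cnj z})"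

definition half_excess :: "nat \<Rightarrow> nat \<Rightarrow> nat \<Rightarrow> real" where
  "half_excess d ep em = (real d - real ep - real em) / 2"

definition jacobi_density :: "nat \<Rightarrow> nat \<Rightarrow> nat \<Rightarrow> (nat \<Rightarrow> real) \<Rightarrow> real" where
  "jacobi_density n ep em \<xi> =
     (\<Prod>j=1..n. 2 ^ (ep + em) * (1 + real ep * cos (\<xi> j)) * (1 - real em * cos (\<xi> j))) *
     (\<Prod>j=1..n. \<Prod>k\<in>{j<..n}. (cos (\<xi> j) - cos (\<xi> k))\<^sup>2)"

text \<open>
  A polynomial in \<open>x\<^sub>1, x\<^sub>2, \<dots>\<close> is a finitely supported map from exponent vectors (themselves
  finitely supported) to coefficients. Since \<open>n \<ge> 1\<close>, a negative \<open>D\<close> leaves no admissible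
  exponent, and the space below is then \<open>{0}\<close>.
\<close>

type_synonym cpoly = "(nat \<Rightarrow>\<^sub>0 nat) \<Rightarrow>\<^sub>0 complex"

definition poly_eval :: "cpoly \<Rightarrow> (nat \<Rightarrow> complex) \<Rightarrow> complex" where
  "poly_eval f x =
     (\<Sum>\<alpha>\<in>Poly_Mapping.keys f. Poly_Mapping.lookup f \<alpha> *
        (\<Prod>j\<in>Poly_Mapping.keys \<alpha>. x j ^ Poly_Mapping.lookup \<alpha> j))"

text \<open>For a permutation \<open>\<sigma>\<close>, \<^term>\<open>Poly_Mapping.map_key \<sigma> \<alpha>\<close> is the exponent vector \<open>\<alpha> \<circ> \<sigma>\<close>.\<close>

definition symmetric_polys :: "int \<Rightarrow> nat \<Rightarrow> cpoly set" where
  "symmetric_polys D n =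
     {f. (\<forall>\<alpha>\<in>Poly_Mapping.keys f. Poly_Mapping.keys \<alpha> \<subseteq> {1..n}) \<and>
         (\<forall>\<alpha>\<in>Poly_Mapping.keys f. \<forall>j\<in>{1..n}. int (Poly_Mapping.lookup \<alpha> j) \<le> D) \<and>
         (\<forall>\<sigma> \<alpha>. \<sigma> permutes {1..n} \<longrightarrow>
            Poly_Mapping.lookup f (Poly_Mapping.map_key \<sigma> \<alpha>) = Poly_Mapping.lookup f \<alpha>)}"

definition index_set :: "nat \<Rightarrow> nat \<Rightarrow> (nat \<Rightarrow> nat) set" where
  "index_set m n =
     {\<mu> \<in> {1..n} \<rightarrow>\<^sub>E {0..m}. \<forall>i\<in>{1..n}. \<forall>j\<in>{1..n}. i \<le> j \<longrightarrow> \<mu> j \<le> \<mu> i}"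

definition poisson_term :: "complex \<Rightarrow> real \<Rightarrow> complex" where
  "poisson_term a \<theta> = (1 - a\<^sup>2) / (1 - 2 * a * of_real (cos \<theta>) + a\<^sup>2)"

text \<open>
  In the following three definitions \<open>N\<close> stands for \<open>m + n\<close>. The interval integral is oriented, so
  the equation makes sense for every real \<open>\<xi>\<close>. Single terms with non-real \<open>a r\<close> are complex; the
  sums are real when the parameters come in conjugate pairs.
\<close>

definition leading_factor ::
  "nat \<Rightarrow> nat \<Rightarrow> nat \<Rightarrow> nat \<Rightarrow> nat \<Rightarrow> nat \<Rightarrow> nat \<Rightarrow> real" where
  "leading_factor N ep em d tp tm d' =
     2 * (real N - 1 - half_excess d ep em - half_excess d' tp tm)"

definition node ::
  "nat \<Rightarrow> nat \<Rightarrow> nat \<Rightarrow> nat \<Rightarrow> (nat \<Rightarrow> complex) \<Rightarrow>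
   nat \<Rightarrow> nat \<Rightarrow> nat \<Rightarrow> (nat \<Rightarrow> complex) \<Rightarrow> nat \<Rightarrow> real" where
  "node N ep em d a tp tm d' a' l =
     (THE \<xi>::real.
        of_real (leading_factor N ep em d tp tm d' * \<xi>) +
        (\<Sum>r=1..d. LBINT \<theta>=0..\<xi>. poisson_term (a r) \<theta>) +
        (\<Sum>r=1..d'. LBINT \<theta>=0..\<xi>. poisson_term (a' r) \<theta>) =
        of_real (pi * (2 * real l + real em + real tm)))"

definition weight ::
  "nat \<Rightarrow> nat \<Rightarrow> nat \<Rightarrow> nat \<Rightarrow> (nat \<Rightarrow> complex) \<Rightarrow>
   nat \<Rightarrow> nat \<Rightarrow> nat \<Rightarrow> (nat \<Rightarrow> complex) \<Rightarrow> nat \<Rightarrow> complex" where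
  "weight N ep em d a tp tm d' a' l =
     (1 / 2) ^ ((1 - em) * (1 - tm) * (if l = 0 then 1 else 0) +
                (1 - ep) * (1 - tp) * (if l = N - 1 then 1 else 0)) *
     inverse
       (of_real (leading_factor N ep em d tp tm d') +
        (\<Sum>r=1..d. poisson_term (a r) (node N ep em d a tp tm d' a' l)) +
        (\<Sum>r=1..d'. poisson_term (a' r) (node N ep em d a tp tm d' a' l)))"

definition multi_node ::
  "nat \<Rightarrow> nat \<Rightarrow> nat \<Rightarrow> nat \<Rightarrow> nat \<Rightarrow> (nat \<Rightarrow> complex) \<Rightarrow>
   nat \<Rightarrow> nat \<Rightarrow> nat \<Rightarrow> (nat \<Rightarrow> complex) \<Rightarrow> (nat \<Rightarrow> nat) \<Rightarrow> nat \<Rightarrow> real" where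
  "multi_node m n ep em d a tp tm d' a' \<mu> =
     (\<lambda>j\<in>{1..n}. node (m + n) ep em d a tp tm d' a' (\<mu> j + (n - j)))"

definition multi_weight ::
  "nat \<Rightarrow> nat \<Rightarrow> nat \<Rightarrow> nat \<Rightarrow> nat \<Rightarrow> (nat \<Rightarrow> complex) \<Rightarrow>
   nat \<Rightarrow> nat \<Rightarrow> nat \<Rightarrow> (nat \<Rightarrow> complex) \<Rightarrow> (nat \<Rightarrow> nat) \<Rightarrow> complex" where
  "multi_weight m n ep em d a tp tm d' a' \<mu> =
     (\<Prod>j=1..n. weight (m + n) ep em d a tp tm d' a' (\<mu> j + (n - j)))"

end

theory Submission
  imports Defs "HOL-Complex_Analysis.Complex_Analysis" "HOL-Computational_Algebra.Polynomial"
begin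

text \<open>
  Write \<open>z = e\<^sup>i\<^sup>\<theta>\<close> and let \<open>C(z)\<close> be the product of all \<open>1 - c z\<close>, where \<open>c\<close> runs through both parameter
  families. The node equation says that the finite Blaschke product
  \<open>B(z) = z\<^sup>K C(1/z) / C(z)\<close> of degree \<open>K = 2(m+n-1) + \<epsilon>\<^sub>+ + \<epsilon>\<^sub>- + \<epsilon>'\<^sub>+ + \<epsilon>'\<^sub>-\<close> (primes for tildes) takes the value
  \<open>s = (-1)\<close> to the power \<open>\<epsilon>\<^sub>- + \<epsilon>'\<^sub>-\<close>, and the weights are \<open>1/\<bar>B'\<bar>\<close> at the \<open>K\<close> solutions,
  halved at \<open>z = \<plusminus>1\<close> since all others come in pairs \<open>e\<^sup>\<plusminus>\<^sup>i\<^sup>\<xi>\<close> with the same cosine. The unhalved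
  quadrature with these nodes and weights is exact for all \<open>t(z) / (C(z) C(1/z))\<close> with a Laurent
  polynomial \<open>t\<close> of degree less than \<open>K\<close>: with \<open>q(z) = z\<^sup>K C(1/z)\<close>, the mean over the circle of
  \<open>z (U C + V q) / (C q)\<close>, where \<open>deg U < K\<close> and \<open>deg V < deg C\<close>, is the coefficient of \<open>z\<^sup>K\<^sup>-\<^sup>1\<close> in \<open>U\<close> by the
  mean value property, and by Lagrange interpolation at the zeros of \<open>q - s C\<close> the same number is the
  value of the quadrature sum. Restricting to even functions gives a rule on \<open>[0, \<pi>]\<close>.

  In several variables, \<open>f\<close> times the squared Vandermonde product is a combination of monomials whose
  exponents are small enough for the one-variable rule. The resulting sum over all tuples of nodes
  has a symmetric summand that vanishes on tuples with repeated nodes, so it is \<open>n!\<close> times the sum over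
  strictly decreasing tuples.
\<close>

subsection \<open>The phase of a Blaschke factor\<close>

text \<open>An antiderivative of the Poisson term, chosen to vanish at \<open>0\<close>.\<close>

definition phase :: "complex \<Rightarrow> real \<Rightarrow> complex" where
  "phase a \<theta> = of_real \<theta> + \<i> * (Ln (1 - a * cis \<theta>) - Ln (1 - a * cis (-\<theta>)))"

text \<open>Keeps \<open>1 - a * cis \<theta>\<close> in the right half-plane, away from the branch
  cut of \<open>Ln\<close>, so both logarithms in \<open>phase\<close> are smooth and commute with
  conjugation.\<close>

lemma Re_one_minus_pos:
  assumes "norm a < 1" shows "Re (1 - a * cis \<theta>) > 0"
proof -
  have "Re (a * cis \<theta>) \<le> norm (a * cis \<theta>)" by (rule complex_Re_le_cmod)
  also have "\<dots> < 1" using assms by (simp add: norm_mult)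
  finally show ?thesis by simp
qed

lemma one_minus_nonzero:
  assumes "norm a < 1" shows "1 - a * cis \<theta> \<noteq> 0"
  using Re_one_minus_pos[OF assms, of \<theta>] by (metis less_irrefl zero_complex.sel(1))

lemma quadratic_factor:
  "1 - 2 * a * of_real (cos \<theta>) + a\<^sup>2 = (1 - a * cis \<theta>) * (1 - a * cis (-\<theta>))"
proof -
  have "cis \<theta> + cis (-\<theta>) = 2 * of_real (cos \<theta>)" "cis \<theta> * cis (-\<theta>) = 1"
    by (auto simp: complex_eq_iff cis_mult)
  then show ?thesis by algebra
qed

lemma quadratic_nonzero: "norm (z :: complex) < 1 \<Longrightarrow> 1 - 2 * z * of_real (cos \<theta>) + z\<^sup>2 \<noteq> 0"
  unfolding quadratic_factor using one_minus_nonzero[of z] by (metis mult_eq_0_iff)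

text \<open>The three summands are the derivatives of the three summands of
  \<open>phase\<close>.\<close>

lemma poisson_term_split:
  assumes "norm a < 1"
  shows "poisson_term a \<theta> =
           1 + a * cis \<theta> / (1 - a * cis \<theta>) + a * cis (-\<theta>) / (1 - a * cis (-\<theta>))"
proof -
  have "cis \<theta> * cis (-\<theta>) = 1" by (simp add: cis_mult)
  then show ?thesis
    unfolding poisson_term_def quadratic_factor
    using one_minus_nonzero[OF assms, of \<theta>] one_minus_nonzero[OF assms, of "-\<theta>"]
    apply (simp add: divide_simps)
    by algebra
qed

lemma poisson_term_minus: "poisson_term a (-\<theta>) = poisson_term a \<theta>"
  by (simp add: poisson_term_def)

lemma has_vector_derivative_phase:
  assumes "norm a < 1"
  shows "(phase a has_vector_derivative poisson_term a \<theta>) (at \<theta> within S)"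
proof -
  have *: "((\<lambda>\<theta>. Ln (1 - a * cis \<theta>)) has_vector_derivative
              (- (a * (\<i> * cis \<theta>)) / (1 - a * cis \<theta>))) (at \<theta> within S)" for \<theta> S
  proof (rule field_vector_diff_chain_within [where g = Ln, unfolded o_def, THEN has_vector_derivative_eq_rhs])
    show "((\<lambda>\<theta>. 1 - a * cis \<theta>) has_vector_derivative - (a * (\<i> * cis \<theta>))) (at \<theta> within S)"
      by (auto intro!: derivative_eq_intros simp: has_vector_derivative_def scaleR_conv_of_real)
    have "1 - a * cis \<theta> \<notin> \<real>\<^sub>\<le>\<^sub>0"
      using Re_one_minus_pos[OF assms, of \<theta>] complex_nonpos_Reals_iff by auto
    then show "(Ln has_field_derivative inverse (1 - a * cis \<theta>))
         (at (1 - a * cis \<theta>) within (\<lambda>x. 1 - a * cis x) ` S)"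
      by (rule has_field_derivative_at_within[OF has_field_derivative_Ln])
  qed (simp add: field_simps)
  have **: "((\<lambda>\<theta>. Ln (1 - a * cis (-\<theta>))) has_vector_derivative
              (a * (\<i> * cis (-\<theta>)) / (1 - a * cis (-\<theta>)))) (at \<theta> within S)"
  proof -
    have "(uminus has_vector_derivative -1) (at \<theta> within S)"
      by (auto intro!: derivative_eq_intros)
    from vector_diff_chain_within[OF this *[of "-\<theta>" "uminus ` S"]] show ?thesis
      by (simp add: o_def)
  qed
  show ?thesis
    unfolding phase_def poisson_term_split[OF assms]
    by (rule derivative_eq_intros * ** refl)+ (simp add: field_simps)
qed

lemma phase_0 [simp]: "phase a 0 = 0"
  and phase_pi [simp]: "phase a pi = of_real pi"
  and phase_minus: "phase a (-\<theta>) = - phase a \<theta>"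
  by (simp_all add: phase_def flip: cis_inverse) (simp add: algebra_simps)

text \<open>The denominator is 1 - a z rather than 1 - cnj(a) z, so for non-real a this factor is in
  general not unimodular and \<open>phase a\<close> is not real. Over a family closed under
  conjugation the factors multiply to a genuine Blaschke product.\<close>

lemma exp_phase:
  assumes "norm a < 1"
  shows "exp (\<i> * phase a \<theta>) = (cis \<theta> - a) / (1 - a * cis \<theta>)"
proof -
  note nz = one_minus_nonzero[OF assms, of \<theta>] one_minus_nonzero[OF assms, of "-\<theta>"]
  have "\<i> * phase a \<theta> = \<i> * of_real \<theta> + (Ln (1 - a * cis (-\<theta>)) - Ln (1 - a * cis \<theta>))"
    by (simp add: phase_def algebra_simps)
  then have "exp (\<i> * phase a \<theta>) = cis \<theta> * ((1 - a * cis (-\<theta>)) / (1 - a * cis \<theta>))"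
    using nz by (simp add: exp_add exp_diff cis_conv_exp)
  also have "\<dots> = (cis \<theta> - a) / (1 - a * cis \<theta>)"
    by (simp add: algebra_simps cis_mult)
  finally show ?thesis .
qed

lemma cnj_phase:
  assumes "norm a < 1"
  shows "cnj (phase a \<theta>) = phase (cnj a) \<theta>"
proof -
  have "cnj (Ln (1 - a * cis \<theta>)) = Ln (1 - cnj a * cis (-\<theta>))" for \<theta>
  proof -
    have "1 - a * cis \<theta> \<notin> \<real>\<^sub>\<le>\<^sub>0"
      using Re_one_minus_pos[OF assms, of \<theta>] complex_nonpos_Reals_iff by auto
    then show ?thesis by (simp add: cnj_Ln cis_cnj)
  qed
  from this[of \<theta>] this[of "-\<theta>"] show ?thesis
    by (simp add: phase_def algebra_simps)
qed

text \<open>The map 1/2 + z/(1 - z) = 1/(1 - z) - 1/2 sends the unit disc to the right half-plane,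
  and the Poisson term is the sum of its values at a e^(i \<theta>) and a e^(-i \<theta>). This
  positivity makes the total phase strictly increasing.\<close>

lemma Re_poisson_term_pos:
  assumes "norm a < 1"
  shows "Re (poisson_term a \<theta>) > 0"
proof -
  have *: "Re (1 / 2 + z / (1 - z)) > 0" if "norm z < 1" for z :: complex
  proof -
    have nz: "1 - z \<noteq> 0" using that by auto
    have "(norm z)\<^sup>2 < 1" using that by (simp add: abs_square_less_1)
    then have "(norm (1 - z))\<^sup>2 < 2 * Re (1 - z)"
      unfolding cmod_power2 by (simp add: power2_eq_square algebra_simps)
    then have "Re (inverse (1 - z)) > 1 / 2"
      using nz unfolding inverse_complex.sel cmod_power2[symmetric] by (simp add: divide_simps)
    moreover have "1 / 2 + z / (1 - z) = inverse (1 - z) - of_real (1 / 2)"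
      using nz by (simp add: field_simps)
    ultimately show ?thesis by (simp only: minus_complex.sel Re_complex_of_real)
  qed
  have "poisson_term a \<theta> = (1 / 2 + (a * cis \<theta>) / (1 - a * cis \<theta>)) +
          (1 / 2 + (a * cis (-\<theta>)) / (1 - a * cis (-\<theta>)))"
    by (simp add: poisson_term_split[OF assms])
  then show ?thesis
    using *[of "a * cis \<theta>"] *[of "a * cis (-\<theta>)"] assms by (simp add: norm_mult)
qed

lemma cnj_poisson_term: "cnj (poisson_term a \<theta>) = poisson_term (cnj a) \<theta>"
  by (simp add: poisson_term_def)

lemma continuous_on_poisson_term:
  assumes "norm a < 1"
  shows "continuous_on S (poisson_term a)"
  unfolding poisson_term_def
  using one_minus_nonzero[OF assms]
  by (intro continuous_intros) (auto simp: quadratic_factor)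

lemma interval_integral_poisson_term:
  assumes "norm a < 1"
  shows "(LBINT \<theta>=0..x. poisson_term a \<theta>) = phase a x"
  using interval_integral_FTC_finite[of 0 x "poisson_term a" "phase a"]
  by (simp add: has_vector_derivative_phase continuous_on_poisson_term assms zero_ereal_def)

subsection \<open>Polynomial identities and mean values\<close>

text \<open>Each \<open>?Q x\<close> is monic of degree \<open>card A - 1\<close> and takes at x the
  value of the derivative of P. The sum is thus the top coefficient of the Lagrange interpolant,
  which is U itself for degree reasons.\<close>

lemma lagrange_leading_coeff:
  fixes U :: "'a::field poly"
  assumes "finite A" "A \<noteq> {}" "degree U < card A" "P = (\<Prod>x\<in>A. [:-x, 1:])"
  shows "(\<Sum>x\<in>A. poly U x / poly (pderiv P) x) = coeff U (card A - 1)"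
proof -
  let ?Q = "\<lambda>x. \<Prod>y\<in>A - {x}. [:-y, 1:]"
  have P': "poly (pderiv P) x = poly (?Q x) x" if "x \<in> A" for x
  proof -
    have "P = [:-x, 1:] * ?Q x"
      using assms(1,4) that by (simp add: prod.remove)
    then have "pderiv P = pderiv ([:-x, 1:] * ?Q x)" by (rule arg_cong)
    also have "\<dots> = [:-x, 1:] * pderiv (?Q x) + ?Q x"
      by (simp only: pderiv_mult pderiv_pCons) simp
    finally show ?thesis by (simp only: poly_add poly_mult) simp
  qed
  have nz: "poly (?Q x) x \<noteq> 0" for x
    using assms(1) by (auto simp: poly_prod)
  have deg: "degree (?Q x) = card A - 1" "coeff (?Q x) (card A - 1) = 1" if "x \<in> A" for x
  proof -
    show "degree (?Q x) = card A - 1"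
      using assms(1) that by (subst degree_prod_eq_sum_degree) auto
    moreover have "lead_coeff (?Q x) = 1"
      by (subst lead_coeff_prod) auto
    ultimately show "coeff (?Q x) (card A - 1) = 1" by simp
  qed
  define L where "L = (\<Sum>x\<in>A. smult (poly U x / poly (pderiv P) x) (?Q x))"
  have "U = L"
  proof (rule poly_eqI_degree[where A = A])
    have "degree L \<le> card A - 1"
      unfolding L_def by (rule degree_sum_le) (use assms(1) deg in \<open>auto intro: order.trans[OF degree_smult_le]\<close>)
    then show "degree L < card A" using assms by (meson card_gt_0_iff diff_less le_less_trans zero_less_one)
    fix z assume z: "z \<in> A"
    have "poly L z = (\<Sum>x\<in>A. if x = z then poly U x / poly (pderiv P) x * poly (?Q x) z else 0)"
      unfolding L_def poly_sum poly_smult using assms(1) z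
      by (intro sum.cong) (auto simp: poly_prod)
    also have "\<dots> = poly U z" using z assms(1) P'[OF z] nz by simp
    finally show "poly U z = poly L z" ..
  qed (use assms in auto)
  then have "coeff U (card A - 1) = coeff L (card A - 1)" by simp
  also have "\<dots> = (\<Sum>x\<in>A. poly U x / poly (pderiv P) x)"
    unfolding L_def coeff_sum by (intro sum.cong) (simp_all add: deg del: One_nat_def)
  finally show ?thesis by simp
qed

text \<open>Induction over the factors, so repeated \<open>c i\<close> need no special treatment; a
  zero \<open>c i\<close> gives the trivial factor 1. The alternative \<open>V = 0\<close> covers
  the empty index set, where no degree is below 0.\<close>

lemma partial_fraction_decomposition:
  fixes q W :: "'a::field poly"
  assumes "finite I" "\<And>i. i \<in> I \<Longrightarrow> c i \<noteq> 0 \<Longrightarrow> poly q (inverse (c i)) \<noteq> 0" "degree W < degree q"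
  shows "\<exists>U V. W = U * (\<Prod>i\<in>I. [:1, - c i:]) + V * q \<and> degree U < degree q \<and>
               (V = 0 \<or> degree V < card I)"
  using assms(1,2)
proof (induction I rule: finite_induct)
  case empty
  show ?case by (intro exI[of _ W] exI[of _ 0]) (use assms(3) in auto)
next
  case (insert i I)
  let ?C = "\<Prod>i\<in>I. [:1, - c i:]"
  obtain U V where UV: "W = U * ?C + V * q" "degree U < degree q" "V = 0 \<or> degree V < card I"
    using insert.IH insert.prems by auto
  show ?case
  proof (cases "c i = 0")
    case True
    then show ?thesis
      using UV insert.hyps by (intro exI[of _ U] exI[of _ V]) (auto simp: one_pCons[symmetric])
  next
    case False
    \<comment> \<open>This \<open>t\<close> makes U - t q vanish at 1/c_i, so the factor 1 - c_i z
      can be split off; the remaining multiple t q goes into V.\<close>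
    define t where "t = poly U (inverse (c i)) / poly q (inverse (c i))"
    have "poly (U - smult t q) (inverse (c i)) = 0"
      using False insert.prems by (simp add: t_def)
    then obtain U' where "U - smult t q = [:- inverse (c i), 1:] * U'"
      by (metis poly_eq_0_iff_dvd dvdE)
    moreover have "[:- inverse (c i), 1:] = smult (- inverse (c i)) [:1, - c i:]"
      using False by simp
    ultimately have U': "U - smult t q = [:1, - c i:] * smult (- inverse (c i)) U'"
      by (simp only: mult_smult_left mult_smult_right)
    define U'' where "U'' = smult (- inverse (c i)) U'"
    have "degree ([:1, - c i:] * U'') \<le> degree q"
      unfolding U''_def U'[symmetric]
      using UV(2) by (intro degree_diff_le order.trans[OF degree_smult_le]) auto
    moreover have "degree ([:1, - c i:] * U'') = Suc (degree U'')" if "U'' \<noteq> 0"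
      using that False by (subst degree_mult_eq) auto
    ultimately have "degree U'' < degree q"
      using UV(2) by (cases "U'' = 0") auto
    moreover have "W = U'' * (\<Prod>i\<in>insert i I. [:1, - c i:]) + (V + smult t ?C) * q"
    proof -
      have "U = [:1, - c i:] * U'' + smult t q"
        using U' unfolding U''_def by (metis diff_add_cancel)
      then have "W = ([:1, - c i:] * U'' + smult t q) * ?C + V * q"
        using UV(1) by metis
      also have "\<dots> = U'' * ([:1, - c i:] * ?C) + (V + smult t ?C) * q"
        by (simp only: distrib_left distrib_right mult_smult_left mult_smult_right ac_simps)
      finally show ?thesis using insert.hyps by simp
    qed
    moreover have "degree (V + smult t ?C) < card (insert i I)"
    proof -
      have "degree ?C \<le> card I"
        by (rule order.trans[OF degree_prod_sum_le[OF insert.hyps(1)]])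
           (use sum_bounded_above[of I "\<lambda>i. degree [:1, - c i:]" 1] in \<open>auto simp: o_def\<close>)
      moreover have "degree V \<le> card I" using UV(3) by auto
      ultimately have "degree (V + smult t ?C) \<le> card I"
        by (intro degree_add_le order.trans[OF degree_smult_le])
      then show ?thesis using insert.hyps by simp
    qed
    ultimately show ?thesis by blast
  qed
qed

text \<open>Cauchy's formula for the full circle, with the lower half folded onto [0, pi] by
  replacing \<theta> with 2 pi - \<theta>.\<close>

lemma symmetric_mean_value:
  assumes "f holomorphic_on cball 0 1"
  shows "((\<lambda>\<theta>. f (cis \<theta>) + f (cis (-\<theta>))) has_integral (2 * of_real pi * f 0)) {0..pi}"
proof -
  have "((\<lambda>u. f u / (u - 0)) has_contour_integral (2 * of_real pi * \<i> * f 0)) (circlepath 0 1)"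
    by (rule Cauchy_integral_circlepath_simple) (use assms in auto)
  then have "((\<lambda>t. f (cis t) * \<i>) has_integral 2 * of_real pi * \<i> * f 0) {0..2*pi}"
    unfolding circlepath_def by (subst (asm) has_contour_integral_part_circlepath_iff) auto
  from has_integral_mult_left[OF this, of "- \<i>"]
  have I: "((\<lambda>t. f (cis t)) has_integral 2 * of_real pi * f 0) {0..2*pi}"
    by (simp add: algebra_simps)
  have cont: "continuous_on S (\<lambda>t. f (cis t))" for S
    by (rule continuous_on_compose2[of "cball 0 1" f]) (auto intro!: continuous_intros holomorphic_on_imp_continuous_on assms)
  have int: "(\<lambda>t. f (cis t)) integrable_on {x..y}" for x y
    by (rule integrable_continuous_real cont)+
  have "((\<lambda>t. f (cis t)) has_integral integral {pi..2*pi} (\<lambda>t. f (cis t))) {pi..2*pi}"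
    using int by (rule integrable_integral)
  from has_integral_affinity[OF this[folded box_real(2)], of "-1" "2*pi"]
  have "((\<lambda>t. f (cis (2*pi - t))) has_integral integral {pi..2*pi} (\<lambda>t. f (cis t))) {0..pi}"
    by simp
  moreover have "cis (2*pi - t) = cis (-t)" for t
    by (simp add: complex_eq_iff)
  ultimately have "((\<lambda>t. f (cis t) + f (cis (-t))) has_integral
      (integral {0..pi} (\<lambda>t. f (cis t)) + integral {pi..2*pi} (\<lambda>t. f (cis t)))) {0..pi}"
    using int by (intro has_integral_add integrable_integral) auto
  also have "integral {0..pi} (\<lambda>t. f (cis t)) + integral {pi..2*pi} (\<lambda>t. f (cis t)) = 2 * of_real pi * f 0"
    using Henstock_Kurzweil_Integration.integral_combine[of 0 pi "2*pi" "\<lambda>t. f (cis t)"] int integral_unique[OF I] by simp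
  finally show ?thesis .
qed

lemma cos_polynomial_split:
  obtains T :: "complex poly" where "degree T \<le> degree Q"
    "\<And>\<theta>. poly Q (of_real (cos \<theta>)) = poly T (cis \<theta>) + poly T (cis (-\<theta>))"
proof -
  have "\<exists>T. degree T \<le> degree Q \<and>
          (\<forall>\<theta>. poly Q (of_real (cos \<theta>)) = poly T (cis \<theta>) + poly T (cis (-\<theta>)))"
  proof (induction Q)
    case 0
    then show ?case by (intro exI[of _ 0]) auto
  next
    case (pCons a Q)
    then obtain T where T: "degree T \<le> degree Q"
      "\<And>\<theta>. poly Q (of_real (cos \<theta>)) = poly T (cis \<theta>) + poly T (cis (-\<theta>))" by auto
    obtain t T0 where t: "T = pCons t T0" by (cases T)
    let ?T = "smult (1/2) (pCons 0 T + T0 + [:a, t:])"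
    show ?case
    proof (cases "Q = 0")
      case True
      then show ?thesis by (intro exI[of _ "[:a/2:]"]) auto
    next
      case False
      have "degree ?T \<le> degree (pCons a Q)"
        using T(1) False t by (auto intro!: degree_add_le split: if_splits simp: degree_pCons_eq_if)
      moreover have "poly (pCons a Q) (of_real (cos \<theta>)) = poly ?T (cis \<theta>) + poly ?T (cis (-\<theta>))" for \<theta>
      proof -
        have "cis \<theta> + cis (-\<theta>) = 2 * of_real (cos \<theta>)" "cis \<theta> * cis (-\<theta>) = 1"
          by (auto simp: complex_eq_iff cis_mult)
        then show ?thesis unfolding poly_pCons T(2) t
          apply (simp add: t field_simps)
          by algebra
      qed
      ultimately show ?thesis by blast
    qed
  qed
  with that show ?thesis by blast
qed

text \<open>\<open>reflect_poly\<close> reverses at the true degree of U; the monomial shifts this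
  to the prescribed degree n. The value at 0 later supplies the mean over the circle.\<close>

lemma shifted_reflection:
  fixes U :: "'a::field poly"
  assumes "degree U \<le> n"
  obtains R where "degree R \<le> n" "\<And>z. z \<noteq> 0 \<Longrightarrow> poly R z = z ^ n * poly U (inverse z)"
    "poly R 0 = coeff U n"
proof
  let ?R = "monom 1 (n - degree U) * reflect_poly U"
  show "degree ?R \<le> n"
    by (rule order.trans[OF degree_mult_le])
       (use assms degree_reflect_poly_le[of U] in \<open>auto simp: degree_monom_eq\<close>)
  show "poly ?R z = z ^ n * poly U (inverse z)" if "z \<noteq> 0" for z
    using that assms by (simp add: poly_reflect_poly_nz poly_monom flip: power_add mult.assoc)
  show "poly ?R 0 = coeff U n"
    using assms by (cases "degree U = n") (auto simp: poly_monom coeff_eq_0)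
qed

subsection \<open>Quadrature on the unit circle\<close>

text \<open>
  Since \<open>h (-K) = h K\<close>, the integers in \<open>(-K, K]\<close> amount to the pairs \<open>\<plusminus>k\<close> with \<open>0 \<le> k \<le> K\<close>,
  where the self-paired \<open>k = 0\<close> and \<open>k = K\<close> are counted twice.
\<close>

lemma sum_symmetric_int:
  fixes h :: "int \<Rightarrow> 'a::field_char_0"
  assumes "K > 0" "h (- int K) = h (int K)"
  shows "(\<Sum>k | - int K < k \<and> k \<le> int K \<and> even (k + int \<sigma>). h k) =
         (\<Sum>k | k \<le> K \<and> even (k + \<sigma>).
            (if k = 0 \<or> k = K then 1 / 2 else 1) * (h (int k) + h (- int k)))"
proof -
  define F where "F k = (if even (k + int \<sigma>) then h k else 0)" for k
  have "(\<Sum>k | - int K < k \<and> k \<le> int K \<and> even (k + int \<sigma>). h k) = sum F {- int K<..int K}"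
    by (rule sum.mono_neutral_cong_left) (auto simp: F_def)
  also have "{- int K<..int K} = (uminus \<circ> int) ` {0<..<K} \<union> ({0} \<union> (int ` {0<..<K} \<union> {int K}))"
  proof (intro set_eqI iffI)
    fix k :: int assume k: "k \<in> {- int K<..int K}"
    consider "k < 0" | "k = 0" | "0 < k" "k < int K" | "k = int K" using k by force
    then show "k \<in> (uminus \<circ> int) ` {0<..<K} \<union> ({0} \<union> (int ` {0<..<K} \<union> {int K}))"
    proof cases
      case 1
      with k show ?thesis by (intro UnI1 image_eqI[of _ _ "nat (-k)"]) auto
    next
      case 3
      then show ?thesis by (intro UnI2 UnI1 image_eqI[of _ _ "nat k"]) auto
    qed auto
  qed (use assms(1) in auto)
  also have "sum F \<dots> = (\<Sum>k\<in>{0<..<K}. F (- int k)) + (F 0 + ((\<Sum>k\<in>{0<..<K}. F (int k)) + F (int K)))"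
    using assms(1)
    by (subst sum.union_disjoint; (subst sum.union_disjoint)?; (subst sum.union_disjoint)?)
       (auto simp: sum.reindex inj_on_def)
  also have "\<dots> = F 0 + F (int K) + (\<Sum>k\<in>{0<..<K}. F (int k) + F (- int k))"
    by (simp add: sum.distrib)
  also have "F 0 = (1 / 2) * (F (int 0) + F (- int 0))" by simp
  also have "F (int K) = (1 / 2) * (F (int K) + F (- int K))" using assms by (simp add: F_def)
  also have "(1 / 2) * (F (int 0) + F (- int 0)) + (1 / 2) * (F (int K) + F (- int K)) +
      (\<Sum>k\<in>{0<..<K}. F (int k) + F (- int k)) =
      (\<Sum>k\<in>insert 0 (insert K {0<..<K}). (if k = 0 \<or> k = K then 1 / 2 else 1) * (F (int k) + F (- int k)))"
    using assms(1) by (simp add: add.assoc)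
  also have "insert 0 (insert K {0<..<K}) = {..K}" using assms(1) by auto
  also have "(\<Sum>k\<le>K. (if k = 0 \<or> k = K then 1 / 2 else 1) * (F (int k) + F (- int k))) =
      (\<Sum>k | k \<le> K \<and> even (k + \<sigma>). (if k = 0 \<or> k = K then 1 / 2 else 1) * (h (int k) + h (- int k)))"
    by (rule sum.mono_neutral_cong_right) (auto simp: F_def)
  finally show ?thesis .
qed

lemma card_parity_interval:
  "card {k. - int K < k \<and> k \<le> int K \<and> even (k + int \<sigma>)} = K"
proof -
  \<comment> \<open>The offset \<open>e\<close>, 0 or 1, makes - K + 1 + e the least admissible
    integer; from there, K integers at distance 2 exhaust the interval.\<close>
  define e where "e = (K + 1 + \<sigma>) mod 2"
  have "{k. - int K < k \<and> k \<le> int K \<and> even (k + int \<sigma>)} = (\<lambda>j. 2 * int j - int K + 1 + int e) ` {..<K}"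
  proof (intro set_eqI iffI)
    fix k assume "k \<in> {k. - int K < k \<and> k \<le> int K \<and> even (k + int \<sigma>)}"
    then have k: "- int K < k" "k \<le> int K" "even (k + int \<sigma>)" by auto
    have *: "even (k + int K - 1 - int e)" "e \<le> 1" using k(3) unfolding e_def by presburger+
    then have "k + int K - 1 - int e \<ge> 0" using k by presburger
    with k * show "k \<in> (\<lambda>j. 2 * int j - int K + 1 + int e) ` {..<K}"
      by (intro image_eqI[of _ _ "nat ((k + int K - 1 - int e) div 2)"]) auto
  next
    fix k assume "k \<in> (\<lambda>j. 2 * int j - int K + 1 + int e) ` {..<K}"
    then obtain j where "j < K" "k = 2 * int j - int K + 1 + int e" by auto
    moreover have "e \<le> 1" "even (int e + int K + 1 + int \<sigma>)" unfolding e_def by presburger+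
    ultimately show "k \<in> {k. - int K < k \<and> k \<le> int K \<and> even (k + int \<sigma>)}"
      by auto
  qed
  then show ?thesis by (simp add: card_image inj_on_def)
qed

text \<open>
  With \<open>B = num / den\<close> the Blaschke product of degree \<open>K\<close> below, \<open>B(z) = exp (\<i> Phi \<theta>)\<close> for \<open>z = e\<^sup>i\<^sup>\<theta>\<close>.
  The assumption \<open>sum_cnj\<close> says that the family is closed under conjugation with multiplicities.
\<close>

locale blaschke_phase =
  fixes I :: "'i set" and c :: "'i \<Rightarrow> complex" and K :: nat
  assumes finite_I: "finite I"
    and norm_c: "i \<in> I \<Longrightarrow> norm (c i) < 1"
    and sum_cnj: "\<And>h :: complex \<Rightarrow> complex. (\<Sum>i\<in>I. h (cnj (c i))) = (\<Sum>i\<in>I. h (c i))"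
    and card_less: "card I < K"
begin

section \<open>Total phase, its inverse, and the Blaschke product\<close>

definition Phi :: "real \<Rightarrow> real" where
  "Phi \<theta> = (real K - real (card I)) * \<theta> + (\<Sum>i\<in>I. Re (phase (c i) \<theta>))"

definition Phi' :: "real \<Rightarrow> real" where
  "Phi' \<theta> = (real K - real (card I)) + (\<Sum>i\<in>I. Re (poisson_term (c i) \<theta>))"

text \<open>Inverts \<open>Phi\<close> / pi on [-K, K]: with B = exp(i \<open>Phi\<close>), an
  integer x in this range gives a point of the circle where B = (-1)^x.\<close>

definition angle :: "real \<Rightarrow> real" where
  "angle x = (THE \<theta>. Phi \<theta> = pi * x)"

text \<open>\<open>den\<close> and \<open>num\<close> are the polynomials C and q of the
  introduction.\<close>

definition den :: "complex poly" where
  "den = (\<Prod>i\<in>I. [:1, - c i:])"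

definition num :: "complex poly" where
  "num = monom 1 (K - card I) * (\<Prod>i\<in>I. [:- c i, 1:])"

lemma K_pos: "K > 0"
  using card_less by simp

text \<open>The sum over the family is fixed by conjugation, hence real. So nothing is lost when
  \<open>Phi\<close> and \<open>Phi'\<close> take real parts term by term, which makes them real
  functions open to monotonicity arguments.\<close>

lemma of_real_sum_Re:
  assumes "\<And>i. i \<in> I \<Longrightarrow> cnj (h (c i)) = h (cnj (c i))"
  shows "of_real (\<Sum>i\<in>I. Re (h (c i))) = (\<Sum>i\<in>I. h (c i))"
proof -
  have "cnj (\<Sum>i\<in>I. h (c i)) = (\<Sum>i\<in>I. h (c i))"
    using assms sum_cnj[of h] by simp
  then have "(\<Sum>i\<in>I. h (c i)) \<in> \<real>" by (simp add: Reals_cnj_iff)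
  then show ?thesis by (simp add: complex_is_Real_iff complex_eq_iff)
qed

lemma of_real_Phi:
  "of_real (Phi \<theta>) = of_real ((real K - real (card I)) * \<theta>) + (\<Sum>i\<in>I. phase (c i) \<theta>)"
  unfolding Phi_def of_real_add
  by (subst of_real_sum_Re[of "\<lambda>z. phase z \<theta>"]) (simp_all add: cnj_phase norm_c)

lemma of_real_Phi':
  "of_real (Phi' \<theta>) = of_real (real K - real (card I)) + (\<Sum>i\<in>I. poisson_term (c i) \<theta>)"
  unfolding Phi'_def of_real_add
  by (subst of_real_sum_Re[of "\<lambda>z. poisson_term z \<theta>"]) (simp_all add: cnj_poisson_term)

lemma Phi_DERIV: "(Phi has_real_derivative Phi' \<theta>) (at \<theta> within S)"
proof -
  have "((\<lambda>\<theta>. Re (phase (c i) \<theta>)) has_real_derivative Re (poisson_term (c i) \<theta>)) (at \<theta> within S)"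
    if "i \<in> I" for i
    unfolding has_real_derivative_iff_has_vector_derivative
    by (rule bounded_linear.has_vector_derivative[OF bounded_linear_Re])
       (rule has_vector_derivative_phase[OF norm_c[OF that]])
  then show ?thesis
    unfolding Phi_def Phi'_def
    by (intro DERIV_add DERIV_cmult_Id DERIV_sum) blast
qed

lemma Phi'_pos: "Phi' \<theta> > 0"
  unfolding Phi'_def using card_less
  by (intro add_pos_nonneg sum_nonneg less_imp_le[OF Re_poisson_term_pos] norm_c) auto

lemma strict_mono_Phi: "strict_mono Phi"
  using DERIV_pos_imp_increasing[of _ _ Phi] Phi_DERIV Phi'_pos
  by (intro strict_monoI) blast

lemma Phi_0 [simp]: "Phi 0 = 0"
  by (simp add: Phi_def)

lemma Phi_pi [simp]: "Phi pi = pi * real K"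
  by (simp add: Phi_def algebra_simps)

lemma Phi_minus [simp]: "Phi (-\<theta>) = - Phi \<theta>"
  by (simp add: Phi_def phase_minus sum_negf)

lemma Phi'_minus [simp]: "Phi' (-\<theta>) = Phi' \<theta>"
  by (simp add: Phi'_def poisson_term_minus)

lemma angle_eqI: "Phi \<theta> = pi * x \<Longrightarrow> angle x = \<theta>"
  unfolding angle_def by (rule the_equality, assumption) (metis strict_mono_eq[OF strict_mono_Phi])

lemma Phi_angle:
  assumes "\<bar>x\<bar> \<le> real K"
  shows "Phi (angle x) = pi * x"
proof -
  have "\<exists>\<theta>\<ge>-pi. \<theta> \<le> pi \<and> Phi \<theta> = pi * x"
  proof (rule IVT')
    show "continuous_on {-pi..pi} Phi"
      by (rule DERIV_continuous_on[OF Phi_DERIV])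
    show "Phi (-pi) \<le> pi * x"
      using mult_left_mono[of "- real K" x pi] assms by (simp add: abs_le_iff)
    show "pi * x \<le> Phi pi"
      using assms by (simp add: abs_le_iff)
  qed simp
  then show ?thesis using angle_eqI by blast
qed

lemma angle_0 [simp]: "angle 0 = 0"
  by (rule angle_eqI) simp

lemma angle_K [simp]: "angle (real K) = pi"
  by (rule angle_eqI) simp

lemma angle_minus: "\<bar>x\<bar> \<le> real K \<Longrightarrow> angle (-x) = - angle x"
  by (rule angle_eqI) (simp add: Phi_angle)

lemma angle_less_iff: "\<bar>x\<bar> \<le> real K \<Longrightarrow> \<bar>y\<bar> \<le> real K \<Longrightarrow> angle x < angle y \<longleftrightarrow> x < y"
  using strict_mono_less[OF strict_mono_Phi, of "angle x" "angle y"] by (simp add: Phi_angle)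

lemma poly_den: "poly den z = (\<Prod>i\<in>I. 1 - c i * z)"
  by (simp add: den_def poly_prod mult.commute)

lemma poly_num: "poly num z = z ^ (K - card I) * (\<Prod>i\<in>I. z - c i)"
  by (simp add: num_def poly_prod poly_monom)

lemma den_nonzero: "norm z \<le> 1 \<Longrightarrow> poly den z \<noteq> 0"
proof
  assume z: "norm z \<le> 1" and "poly den z = 0"
  then obtain i where i: "i \<in> I" "1 - c i * z = 0"
    unfolding poly_den prod_zero_iff[OF finite_I] by blast
  have "norm (c i * z) < 1"
    using mult_left_mono[OF z, of "norm (c i)"] norm_c[OF i(1)] by (simp add: norm_mult)
  with i(2) show False by (metis eq_iff_diff_eq_0 less_irrefl norm_one)
qed

lemma num_reflection:
  assumes "z \<noteq> 0"
  shows "poly num z = z ^ K * poly den (inverse z)"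
proof -
  have "z ^ card I * (\<Prod>i\<in>I. 1 - c i * inverse z) = (\<Prod>i\<in>I. z * (1 - c i * inverse z))"
    by (simp add: prod.distrib)
  also have "\<dots> = (\<Prod>i\<in>I. z - c i)"
    using assms by (intro prod.cong) (auto simp: algebra_simps)
  finally have *: "(\<Prod>i\<in>I. z - c i) = z ^ card I * (\<Prod>i\<in>I. 1 - c i * inverse z)" ..
  have "poly num z = z ^ (K - card I) * (\<Prod>i\<in>I. z - c i)"
    by (rule poly_num)
  also have "\<dots> = z ^ ((K - card I) + card I) * (\<Prod>i\<in>I. 1 - c i * inverse z)"
    by (simp only: * power_add mult.assoc)
  also have "\<dots> = z ^ K * poly den (inverse z)"
    using card_less by (simp add: poly_den)
  finally show ?thesis .
qed

lemma degree_num: "degree num = K" "coeff num K = 1"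
proof -
  have nz: "(\<Prod>i\<in>I. [:- c i, 1:]) \<noteq> 0" using finite_I by simp
  have "degree (\<Prod>i\<in>I. [:- c i, 1:]) = card I" by (subst degree_prod_sum_eq) auto
  then show deg: "degree num = K"
    unfolding num_def using nz card_less by (subst degree_mult_eq) (auto simp: degree_monom_eq)
  have "lead_coeff num = 1"
    unfolding num_def lead_coeff_mult lead_coeff_prod by (simp add: degree_monom_eq)
  then show "coeff num K = 1" by (simp add: deg)
qed

lemma degree_den: "degree den < K"
proof -
  have "degree den \<le> (\<Sum>i\<in>I. degree [:1, - c i:])"
    unfolding den_def using degree_prod_sum_le[OF finite_I, of "\<lambda>i. [:1, - c i:]"] by (simp add: o_def)
  also have "\<dots> \<le> card I"
    using sum_bounded_above[of I "\<lambda>i. degree [:1, - c i:]" 1] by simp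
  finally show ?thesis using card_less by simp
qed

text \<open>The exponential turns the sum of phases into the product of the factors in
  \<open>exp_phase\<close>, and the linear term into the power of z in \<open>num\<close>.\<close>

lemma cis_Phi: "cis (Phi \<theta>) * poly den (cis \<theta>) = poly num (cis \<theta>)"
proof -
  have "cis (Phi \<theta>) = exp (\<i> * of_real (Phi \<theta>))" by (simp add: cis_conv_exp)
  also have "\<dots> = cis (real (K - card I) * \<theta>) * (\<Prod>i\<in>I. exp (\<i> * phase (c i) \<theta>))"
    using card_less unfolding of_real_Phi
    by (simp add: distrib_left exp_add cis_conv_exp sum_distrib_left exp_sum finite_I of_nat_diff)
  also have "\<dots> = cis \<theta> ^ (K - card I) * (\<Prod>i\<in>I. (cis \<theta> - c i) / (1 - c i * cis \<theta>))"
    by (simp only: exp_phase norm_c Complex.DeMoivre cong: prod.cong)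
  finally have "cis (Phi \<theta>) * poly den (cis \<theta>) =
      cis \<theta> ^ (K - card I) * (\<Prod>i\<in>I. (cis \<theta> - c i) / (1 - c i * cis \<theta>) * (1 - c i * cis \<theta>))"
    by (simp only: poly_den prod.distrib mult.assoc)
  also have "\<dots> = cis \<theta> ^ (K - card I) * (\<Prod>i\<in>I. cis \<theta> - c i)"
    using one_minus_nonzero[OF norm_c] by simp
  also have "\<dots> = poly num (cis \<theta>)"
    by (simp add: poly_num)
  finally show ?thesis .
qed

section \<open>Zeros of the node polynomial and quadrature on the full circle\<close>

context
  fixes \<sigma> :: nat
begin

definition indices :: "int set" where
  "indices = {k. - int K < k \<and> k \<le> int K \<and> even (k + int \<sigma>)}"

definition root :: "int \<Rightarrow> complex" where
  "root k = cis (angle (of_int k))"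

text \<open>The zeros are the \<open>K\<close> solutions of \<open>B(z) = (-1)\<^sup>\<sigma>\<close>.\<close>

definition node_poly :: "complex poly" where
  "node_poly = num - smult ((-1) ^ \<sigma>) den"

lemma finite_indices: "finite indices"
  by (rule finite_subset[of _ "{- int K..int K}"]) (auto simp: indices_def)

lemma abs_indices: "k \<in> indices \<Longrightarrow> \<bar>real_of_int k\<bar> \<le> real K"
  by (auto simp: indices_def)

text \<open>The half-open index range puts the angles into (-pi, pi], where \<open>Arg\<close>
  undoes \<open>cis\<close>; admitting -K as well could count z = -1 twice.\<close>

lemma inj_root: "inj_on root indices"
proof (rule inj_onI)
  fix k l assume kl: "k \<in> indices" "l \<in> indices" "root k = root l"
  have *: "- pi < angle (of_int k)" "angle (of_int k) \<le> pi" if "k \<in> indices" for k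
  proof -
    have "angle (- real K) < angle (of_int k)" "\<not> angle (real K) < angle (of_int k)"
      using angle_less_iff[of "- real K" "of_int k"] angle_less_iff[of "real K" "of_int k"]
        abs_indices[OF that] that by (auto simp: indices_def simp del: angle_K)
    then show "- pi < angle (of_int k)" "angle (of_int k) \<le> pi"
      by (simp_all add: angle_minus)
  qed
  have "Arg (root k) = angle (of_int k)" "Arg (root l) = angle (of_int l)"
    unfolding root_def using *[OF kl(1)] *[OF kl(2)] by (simp_all add: Arg_cis)
  then have "Phi (angle (of_int k)) = Phi (angle (of_int l))" using kl(3) by simp
  then show "k = l" using abs_indices[OF kl(1)] abs_indices[OF kl(2)] by (simp add: Phi_angle)
qed

lemma cis_Phi_root:
  assumes "k \<in> indices"
  shows "cis (Phi (angle (of_int k))) = (-1) ^ \<sigma>"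
proof -
  have "even k = even (int \<sigma>)" using assms by (auto simp: indices_def)
  then have "cis (pi * of_int k) = (-1) ^ \<sigma>"
    by (auto simp: complex_eq_iff uminus_power_if cos_npi_int sin_zero_iff_int2 mult.commute)
  then show ?thesis using assms by (simp add: Phi_angle abs_indices)
qed

lemma num_root: "k \<in> indices \<Longrightarrow> poly num (root k) = (-1) ^ \<sigma> * poly den (root k)"
  using cis_Phi[of "angle (of_int k)"] cis_Phi_root[of k] by (simp add: root_def)

text \<open>Both sides are monic of degree K, because \<open>den\<close> has smaller degree, and
  they agree at K distinct points.\<close>

lemma node_poly_eq: "node_poly = (\<Prod>z\<in>root ` indices. [:-z, 1:])"
proof (rule poly_eqI_degree_lead_coeff[where n = K and A = "root ` indices"])
  have card: "card (root ` indices) = K"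
    unfolding card_image[OF inj_root] unfolding indices_def by (rule card_parity_interval)
  have deg: "degree (\<Prod>z\<in>root ` indices. [:-z, 1:]) = K"
    by (subst degree_prod_sum_eq) (auto simp: card)
  show "K \<le> card (root ` indices)" using card by simp
  show "degree (\<Prod>z\<in>root ` indices. [:-z, 1:]) \<le> K" using deg by simp
  have "lead_coeff (\<Prod>z\<in>root ` indices. [:-z, 1:]) = 1" by (simp add: lead_coeff_prod)
  then show "coeff node_poly K = coeff (\<Prod>z\<in>root ` indices. [:-z, 1:]) K"
    using degree_den by (simp add: node_poly_def degree_num coeff_eq_0 deg)
  show "degree node_poly \<le> K"
    unfolding node_poly_def using degree_den degree_num
    by (intro degree_diff_le order.trans[OF degree_smult_le]) auto
  fix z assume "z \<in> root ` indices"
  then show "poly node_poly z = poly (\<Prod>z\<in>root ` indices. [:-z, 1:]) z"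
    using finite_indices by (auto simp: node_poly_def num_root poly_prod)
qed

text \<open>The identity \<open>cis_Phi\<close> is differentiated in \<theta>, once directly and
  once by the product rule, and compared at an angle where the exponential is (-1)^\<sigma>. This
  brings \<open>Phi'\<close> into the Lagrange denominators.\<close>

lemma pderiv_node_poly:
  assumes k: "k \<in> indices"
  shows "root k * poly (pderiv node_poly) (root k) =
           (-1) ^ \<sigma> * poly den (root k) * of_real (Phi' (angle (of_int k)))"
proof -
  define \<theta> where "\<theta> = angle (of_int k)"
  have cis: "(cis has_vector_derivative \<i> * cis \<theta>) (at \<theta>)"
    by (auto intro!: derivative_eq_intros simp: has_vector_derivative_def scaleR_conv_of_real)
  have poly: "((\<lambda>\<theta>. poly p (cis \<theta>)) has_vector_derivative \<i> * cis \<theta> * poly (pderiv p) (cis \<theta>)) (at \<theta>)" for p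
    using field_vector_diff_chain_at[OF cis poly_DERIV] by (simp add: o_def)
  have "((\<lambda>\<theta>. cis (Phi \<theta>)) has_vector_derivative of_real (Phi' \<theta>) * (\<i> * cis (Phi \<theta>))) (at \<theta>)"
  proof -
    have "(cis has_vector_derivative \<i> * cis (Phi \<theta>)) (at (Phi \<theta>))"
      by (auto intro!: derivative_eq_intros simp: has_vector_derivative_def scaleR_conv_of_real)
    from vector_diff_chain_at[OF Phi_DERIV[unfolded has_real_derivative_iff_has_vector_derivative] this]
    show ?thesis by (simp add: o_def scaleR_conv_of_real)
  qed
  from has_vector_derivative_mult[OF this poly[of den]]
  have "((\<lambda>\<theta>. poly num (cis \<theta>)) has_vector_derivative
          cis (Phi \<theta>) * (\<i> * cis \<theta> * poly (pderiv den) (cis \<theta>)) +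
          of_real (Phi' \<theta>) * (\<i> * cis (Phi \<theta>)) * poly den (cis \<theta>)) (at \<theta>)"
    by (simp add: cis_Phi)
  from vector_derivative_unique_at[OF this poly[of num]]
  have "(-1) ^ \<sigma> * (\<i> * root k * poly (pderiv den) (root k)) +
          of_real (Phi' \<theta>) * (\<i> * (-1) ^ \<sigma>) * poly den (root k) =
        \<i> * root k * poly (pderiv num) (root k)"
    using cis_Phi_root[OF k] by (simp add: \<theta>_def root_def)
  then have "\<i> * (root k * poly (pderiv node_poly) (root k)) =
      \<i> * ((-1) ^ \<sigma> * poly den (root k) * of_real (Phi' \<theta>))"
    by (simp add: node_poly_def pderiv_diff pderiv_smult algebra_simps)
  then show ?thesis by (simp add: \<theta>_def)
qed

lemma circle_quadrature:
  assumes "degree W < K"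
  defines "g \<equiv> \<lambda>z. z * poly W z / (poly den z * poly num z)"
  shows "((\<lambda>\<theta>. g (cis \<theta>) + g (cis (-\<theta>))) has_integral
            2 * of_real pi * (\<Sum>k\<in>indices. g (root k) / of_real (Phi' (angle (of_int k))))) {0..pi}"
proof -
  have "\<exists>U V. W = U * den + V * num \<and> degree U < degree num \<and> (V = 0 \<or> degree V < card I)"
    unfolding den_def
  proof (rule partial_fraction_decomposition[OF finite_I])
    fix i assume i: "i \<in> I" "c i \<noteq> 0"
    then have "poly num (inverse (c i)) = inverse (c i) ^ K * poly den (c i)"
      by (simp add: num_reflection)
    then show "poly num (inverse (c i)) \<noteq> 0"
      using i den_nonzero[of "c i"] norm_c[OF i(1)] by auto
  qed (use assms degree_num in auto)
  then obtain U V where W: "W = U * den + V * num" and U: "degree U < K" and V: "V = 0 \<or> degree V < card I"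
    using degree_num by auto
  obtain R where R: "degree R \<le> K - 1" "\<And>z. z \<noteq> 0 \<Longrightarrow> poly R z = z ^ (K - 1) * poly U (inverse z)"
    "poly R 0 = coeff U (K - 1)"
    by (rule shifted_reflection[of U "K - 1"]) (use U in auto)
  \<comment> \<open>On the circle \<open>z U(z) / num(z)\<close> equals \<open>R(1/z) / den(1/z)\<close>, and \<open>R / den\<close> is holomorphic on the disc.\<close>
  define f where "f = (\<lambda>z. poly R z / poly den z + z * poly V z / poly den z)"
  have "f holomorphic_on cball 0 1"
    unfolding f_def by (intro holomorphic_intros) (auto simp: den_nonzero)
  from symmetric_mean_value[OF this]
  have "((\<lambda>\<theta>. f (cis \<theta>) + f (cis (-\<theta>))) has_integral 2 * of_real pi * coeff U (K - 1)) {0..pi}"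
    by (simp add: f_def R poly_den)
  \<comment> \<open>The functions f and g differ in general: the part coming from U is evaluated at
    conjugate points. Only the symmetrized sums agree.\<close>
  moreover have "f (cis \<theta>) + f (cis (-\<theta>)) = g (cis \<theta>) + g (cis (-\<theta>))" for \<theta>
  proof -
    have *: "g (cis \<theta>) = poly R (cis (-\<theta>)) / poly den (cis (-\<theta>)) + cis \<theta> * poly V (cis \<theta>) / poly den (cis \<theta>)" for \<theta>
    proof -
      have inv: "inverse (cis \<theta>) = cis (-\<theta>)" "inverse (cis (-\<theta>)) = cis \<theta>" by simp_all
      have nz: "poly den (cis \<theta>) \<noteq> 0" "poly den (cis (-\<theta>)) \<noteq> 0" by (simp_all add: den_nonzero)
      have num: "poly num (cis \<theta>) = cis \<theta> ^ K * poly den (cis (-\<theta>))"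
        by (simp add: num_reflection)
      have R': "cis \<theta> ^ K * poly R (cis (-\<theta>)) = cis \<theta> * poly U (cis \<theta>)"
      proof -
        have "cis \<theta> ^ K * cis (-\<theta>) ^ (K - 1) = cis \<theta>"
          using K_pos by (cases K) (simp_all flip: cis_inverse add: power_inverse)
        then show ?thesis by (simp add: R flip: mult.assoc)
      qed
      have nz': "poly num (cis \<theta>) \<noteq> 0" using nz num by simp
      have "g (cis \<theta>) = cis \<theta> * poly U (cis \<theta>) / poly num (cis \<theta>) + cis \<theta> * poly V (cis \<theta>) / poly den (cis \<theta>)"
        using nz nz' unfolding g_def W by (simp add: field_simps)
      also have "cis \<theta> * poly U (cis \<theta>) / poly num (cis \<theta>) = poly R (cis (-\<theta>)) / poly den (cis (-\<theta>))"
        unfolding R'[symmetric] num by simp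
      finally show ?thesis .
    qed
    from *[of \<theta>] *[of "-\<theta>"] show ?thesis by (simp add: f_def)
  qed
  moreover have "(\<Sum>k\<in>indices. g (root k) / of_real (Phi' (angle (of_int k)))) = coeff U (K - 1)"
  proof -
    let ?s = "(-1) ^ \<sigma> :: complex"
    \<comment> \<open>Since \<open>card I\<close> is at most K - 1, V does not reach the exponent K
      - 1. At the nodes \<open>num\<close> = s \<open>den\<close>, hence W = (U + s V)
      \<open>den\<close>; this is why U + s V is the polynomial to interpolate.\<close>
    have V0: "coeff (smult ?s V) (K - 1) = 0"
      using V card_less by (auto intro: coeff_eq_0)
    have "degree (U + smult ?s V) < K"
      using U V card_less by (intro degree_add_less le_less_trans[OF degree_smult_le]) auto
    moreover have "card (root ` indices) = K"
      unfolding card_image[OF inj_root] unfolding indices_def by (rule card_parity_interval)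
    ultimately have "(\<Sum>z\<in>root ` indices. poly (U + smult ?s V) z / poly (pderiv node_poly) z) = coeff (U + smult ?s V) (K - 1)"
      using lagrange_leading_coeff[OF _ _ _ node_poly_eq, of "U + smult ?s V"] finite_indices K_pos
      by (metis card.empty finite_imageI not_less0)
    also have "\<dots> = coeff U (K - 1)" using V0 by simp
    also have "(\<Sum>z\<in>root ` indices. poly (U + smult ?s V) z / poly (pderiv node_poly) z) =
        (\<Sum>k\<in>indices. poly (U + smult ?s V) (root k) / poly (pderiv node_poly) (root k))"
      by (rule sum.reindex[OF inj_root, unfolded o_def])
    also have "\<dots> = (\<Sum>k\<in>indices. g (root k) / of_real (Phi' (angle (of_int k))))"
    proof (rule sum.cong[OF refl])
      fix k assume k: "k \<in> indices"
      define \<phi> where "\<phi> = complex_of_real (Phi' (angle (of_int k)))"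
      have \<phi>: "\<phi> \<noteq> 0" using Phi'_pos[of "angle (of_int k)"] by (simp add: \<phi>_def)
      have d: "poly den (root k) \<noteq> 0" by (simp add: den_nonzero root_def)
      have r: "root k \<noteq> 0" by (simp add: root_def)
      have ss: "?s * ?s = 1" by (simp flip: power_mult_distrib)
      then have s: "?s \<noteq> 0" by auto
      have P: "poly (pderiv node_poly) (root k) = ?s * poly den (root k) * \<phi> / root k"
        using pderiv_node_poly[OF k] r by (simp add: \<phi>_def field_simps)
      have "g (root k) / \<phi> = root k * (poly U (root k) * poly den (root k) + poly V (root k) * (?s * poly den (root k)))
           / (poly den (root k) * (?s * poly den (root k)) * \<phi>)"
        unfolding g_def W num_root[OF k] poly_add poly_mult num_root[OF k] by simp
      also have "\<dots> = poly (U + smult ?s V) (root k) / poly (pderiv node_poly) (root k)"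
        unfolding P using s d r \<phi> by (simp add: field_simps)
      finally show "poly (U + smult ?s V) (root k) / poly (pderiv node_poly) (root k) = g (root k) / complex_of_real (Phi' (angle (of_int k)))"
        by (simp add: \<phi>_def)
    qed
    finally show ?thesis by simp
  qed
  ultimately show ?thesis by simp
qed

text \<open>The numerator is T(z) + T(1/z), and W = z^(K-1) T(1/z) turns z W / (den num) into T(1/z)
  / (den(z) den(1/z)), so G is a symmetrization to which the circle rule applies. Conjugate roots
  share their cosine and \<open>Phi'\<close>; pairing them leaves a factor 1/2 at the self-conjugate
  points 1 and -1.\<close>

theorem bernstein_szego_quadrature:
  assumes "degree Q < K"
  defines "G \<equiv> \<lambda>\<theta>. poly Q (of_real (cos \<theta>)) / (\<Prod>i\<in>I. 1 - 2 * c i * of_real (cos \<theta>) + (c i)\<^sup>2)"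
  shows "(G has_integral 2 * of_real pi *
           (\<Sum>k | k \<le> K \<and> even (k + \<sigma>). (if k = 0 \<or> k = K then 1 / 2 else 1) *
              G (angle (real k)) / of_real (Phi' (angle (real k))))) {0..pi}"
proof -
  obtain T where T: "degree T \<le> degree Q"
    "\<And>\<theta>. poly Q (of_real (cos \<theta>)) = poly T (cis \<theta>) + poly T (cis (-\<theta>))"
    using cos_polynomial_split[of Q] by blast
  obtain W where W: "degree W \<le> K - 1" "\<And>z. z \<noteq> 0 \<Longrightarrow> poly W z = z ^ (K - 1) * poly T (inverse z)"
    by (rule shifted_reflection[of T "K - 1"]) (use T(1) assms(1) in auto)
  define g where "g = (\<lambda>z. z * poly W z / (poly den z * poly num z))"
  have den: "(\<Prod>i\<in>I. 1 - 2 * c i * of_real (cos \<theta>) + (c i)\<^sup>2) = poly den (cis \<theta>) * poly den (cis (-\<theta>))" for \<theta>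
    by (simp add: quadratic_factor poly_den prod.distrib)
  have g: "g (cis \<theta>) = poly T (cis (-\<theta>)) / (poly den (cis \<theta>) * poly den (cis (-\<theta>)))" for \<theta>
  proof -
    have "cis \<theta> * cis \<theta> ^ (K - 1) = cis \<theta> ^ K"
      using K_pos by (metis Suc_pred' power_Suc)
    then have "cis \<theta> * poly W (cis \<theta>) = cis \<theta> ^ K * poly T (cis (-\<theta>))"
      by (simp add: W flip: mult.assoc)
    moreover have "poly num (cis \<theta>) = cis \<theta> ^ K * poly den (cis (-\<theta>))"
      by (simp add: num_reflection)
    ultimately show ?thesis by (simp add: g_def)
  qed
  have gG: "g (cis \<theta>) + g (cis (-\<theta>)) = G \<theta>" for \<theta>
    using g[of \<theta>] g[of "-\<theta>"]
    by (simp add: G_def den T add_divide_distrib mult.commute[of "poly den (cis (- \<theta>))"])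
  have "degree W < K" using W(1) K_pos by simp
  from circle_quadrature[OF this]
  have "((\<lambda>\<theta>. g (cis \<theta>) + g (cis (-\<theta>))) has_integral
          2 * of_real pi * (\<Sum>k\<in>indices. g (root k) / of_real (Phi' (angle (of_int k))))) {0..pi}"
    unfolding g_def .
  then have "(G has_integral 2 * of_real pi * (\<Sum>k\<in>indices. g (root k) / of_real (Phi' (angle (of_int k))))) {0..pi}"
    unfolding gG .
  also have "(\<Sum>k\<in>indices. g (root k) / of_real (Phi' (angle (of_int k)))) =
     (\<Sum>k | k \<le> K \<and> even (k + \<sigma>). (if k = 0 \<or> k = K then 1 / 2 else 1) *
        (g (root (int k)) / of_real (Phi' (angle (of_int (int k)))) + g (root (- int k)) / of_real (Phi' (angle (of_int (- int k))))))"
    unfolding indices_def by (rule sum_symmetric_int[OF K_pos]) (simp add: root_def angle_minus flip: cis_cnj)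
  also have "\<dots> = (\<Sum>k | k \<le> K \<and> even (k + \<sigma>). (if k = 0 \<or> k = K then 1 / 2 else 1) *
              G (angle (real k)) / of_real (Phi' (angle (real k))))"
  proof (rule sum.cong[OF refl])
    fix k assume "k \<in> {k. k \<le> K \<and> even (k + \<sigma>)}"
    then have "angle (of_int (- int k)) = - angle (real k)" by (simp add: angle_minus)
    then show "(if k = 0 \<or> k = K then 1 / 2 else 1) *
        (g (root (int k)) / of_real (Phi' (angle (of_int (int k)))) + g (root (- int k)) / of_real (Phi' (angle (of_int (- int k))))) =
        (if k = 0 \<or> k = K then 1 / 2 else 1) * G (angle (real k)) / of_real (Phi' (angle (real k)))"
      by (simp add: root_def flip: gG add_divide_distrib)
  qed
  finally show ?thesis .
qed

end

end

subsection \<open>The one-variable rule\<close>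

text \<open>Indices are grouped by parameter value; conjugation permutes the set \<open>S\<close> of
  values and their conjugates and preserves multiplicities.\<close>

lemma sum_cnj_conjugate_pairs:
  fixes h :: "complex \<Rightarrow> 'b::comm_ring_1"
  assumes "conjugate_pairs d a"
  shows "(\<Sum>r=1..d. h (cnj (a r))) = (\<Sum>r=1..d. h (a r))"
proof -
  define S where "S = a ` {1..d} \<union> cnj ` a ` {1..d}"
  have S: "finite S" "a ` {1..d} \<subseteq> S"
    unfolding S_def by blast+
  have "cnj ` cnj ` a ` {1..d} = a ` {1..d}"
    by (simp only: image_image complex_cnj_cnj)
  then have cnj_S: "cnj ` S = S"
    unfolding S_def image_Un by blast
  have mult: "card {r \<in> {1..d}. a r = cnj z} = card {r \<in> {1..d}. a r = z}" for z
  proof (cases "z \<in> \<real>")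
    case True
    then show ?thesis by (simp only: Reals_cnj_iff)
  next
    case False
    with assms show ?thesis unfolding conjugate_pairs_def by (metis (no_types))
  qed
  have group: "(\<Sum>r=1..d. g (a r)) = (\<Sum>z\<in>S. of_nat (card {r \<in> {1..d}. a r = z}) * g z)"
    for g :: "complex \<Rightarrow> 'b"
    by (subst sum.group[OF finite_atLeastAtMost S(1,2), symmetric]) simp
  have "(\<Sum>z\<in>S. of_nat (card {r \<in> {1..d}. a r = z}) * h (cnj z)) =
        (\<Sum>z\<in>cnj ` S. of_nat (card {r \<in> {1..d}. a r = cnj z}) * h z)"
    by (subst sum.reindex) (auto simp: inj_on_def)
  then show ?thesis
    using group[of h] group[of "\<lambda>z. h (cnj z)"] by (simp only: cnj_S mult)
qed

locale jacobi_quadrature =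
  fixes N ep em d tp tm d' :: nat and a a' :: "nat \<Rightarrow> complex"
  assumes eps: "ep \<in> {0, 1}" "em \<in> {0, 1}" "tp \<in> {0, 1}" "tm \<in> {0, 1}"
    and norm_a: "\<And>r. r \<in> {1..d} \<Longrightarrow> norm (a r) < 1"
    and norm_a': "\<And>r. r \<in> {1..d'} \<Longrightarrow> norm (a' r) < 1"
    and conj_a: "conjugate_pairs d a" and conj_a': "conjugate_pairs d' a'"
    and N_pos: "N \<ge> 1"
    and degree_condition: "d + d' < 2 * (N - 1) + ep + em + tp + tm"
begin

text \<open>Both parameter families enter the Blaschke product on the same footing, hence the
  disjoint sum. They separate only in the integrand, which carries the denominators of the first
  family alone.\<close>

sublocale blaschke_phase "{1..d} <+> {1..d'}" "case_sum a a'" "2 * (N - 1) + ep + em + tp + tm"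
proof
  show "(\<Sum>i\<in>{1..d} <+> {1..d'}. h (cnj (case_sum a a' i))) = (\<Sum>i\<in>{1..d} <+> {1..d'}. h (case_sum a a' i))"
    for h :: "complex \<Rightarrow> complex"
    by (simp add: sum.Plus o_def sum_cnj_conjugate_pairs[OF conj_a] sum_cnj_conjugate_pairs[OF conj_a']
        del: One_nat_def)
  show "card ({1..d} <+> {1..d'}) < 2 * (N - 1) + ep + em + tp + tm"
    using degree_condition by (simp add: card_Plus)
qed (auto simp: norm_a norm_a')

abbreviation nd :: "nat \<Rightarrow> real" where
  "nd \<equiv> node N ep em d a tp tm d' a'"

abbreviation wt :: "nat \<Rightarrow> complex" where
  "wt \<equiv> weight N ep em d a tp tm d' a'"

text \<open>The contribution of one variable to R times the Jacobi density, apart from f and the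
  Vandermonde factors.\<close>

definition density :: "real \<Rightarrow> complex" where
  "density \<theta> = of_real (2 ^ (ep + em) * (1 + real ep * cos \<theta>) * (1 - real em * cos \<theta>)) /
     (\<Prod>r=1..d. 1 - 2 * a r * of_real (cos \<theta>) + (a r)\<^sup>2)"

lemma leading_factor_eq:
  "leading_factor N ep em d tp tm d' =
     real (2 * (N - 1) + ep + em + tp + tm) - real (card ({1..d} <+> {1..d'}))"
  using N_pos by (simp add: leading_factor_def half_excess_def card_Plus of_nat_diff field_simps)

lemma node_eq: "nd l = angle (real (2 * l + em + tm))"
proof -
  have "(of_real (leading_factor N ep em d tp tm d' * \<xi>) +
        (\<Sum>r=1..d. LBINT \<theta>=0..\<xi>. poisson_term (a r) \<theta>) +
        (\<Sum>r=1..d'. LBINT \<theta>=0..\<xi>. poisson_term (a' r) \<theta>) =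
        complex_of_real (pi * (2 * real l + real em + real tm))) \<longleftrightarrow>
      Phi \<xi> = pi * real (2 * l + em + tm)" for \<xi>
  proof -
    have "of_real (leading_factor N ep em d tp tm d' * \<xi>) +
        (\<Sum>r=1..d. LBINT \<theta>=0..\<xi>. poisson_term (a r) \<theta>) +
        (\<Sum>r=1..d'. LBINT \<theta>=0..\<xi>. poisson_term (a' r) \<theta>) = complex_of_real (Phi \<xi>)"
      unfolding of_real_Phi leading_factor_eq
      by (simp add: sum.Plus interval_integral_poisson_term norm_a norm_a' o_def)
    then show ?thesis
      by (simp only: of_real_eq_iff) simp
  qed
  then show ?thesis unfolding node_def angle_def by simp
qed

lemma weight_eq:
  "wt l = (1 / 2) ^ ((1 - em) * (1 - tm) * (if l = 0 then 1 else 0) +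
                    (1 - ep) * (1 - tp) * (if l = N - 1 then 1 else 0)) / of_real (Phi' (nd l))"
proof -
  have "of_real (leading_factor N ep em d tp tm d') +
        (\<Sum>r=1..d. poisson_term (a r) (nd l)) + (\<Sum>r=1..d'. poisson_term (a' r) (nd l)) =
        complex_of_real (Phi' (nd l))"
    unfolding of_real_Phi' leading_factor_eq by (simp add: sum.Plus o_def)
  then show ?thesis unfolding weight_def by (simp only: divide_inverse)
qed

lemma continuous_on_density: "continuous_on S density"
  unfolding density_def
  by (intro continuous_intros) (use quadratic_nonzero norm_a in auto)

text \<open>The index 2 l + em + tm is 0 precisely for l = 0 and em = tm = 0, and maximal precisely
  for l = N - 1 and ep = tp = 0. Both cannot happen at once because the degree K is
  positive.\<close>

lemma weight_factor:
  assumes "l < N"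
  shows "(1 / 2 :: complex) ^ ((1 - em) * (1 - tm) * (if l = 0 then 1 else 0) +
             (1 - ep) * (1 - tp) * (if l = N - 1 then 1 else 0)) =
         (if 2 * l + em + tm = 0 \<or> 2 * l + em + tm = 2 * (N - 1) + ep + em + tp + tm then 1 / 2 else 1)"
  using eps assms K_pos by auto

text \<open>Expanding the fraction by the quadratic factors of the second family gives the
  denominator of the general rule. The new numerator has degree at most k + ep + em + d', which is
  below K by assumption.\<close>

theorem one_variable_quadrature:
  assumes "k + d' < 2 * (N - 1) + tp + tm"
  shows "((\<lambda>\<theta>. of_real (cos \<theta>) ^ k * density \<theta>) has_integral
           2 * of_real pi * (\<Sum>l<N. of_real (cos (nd l)) ^ k * density (nd l) * wt l)) {0..pi}"
proof -
  let ?K = "2 * (N - 1) + ep + em + tp + tm"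
  define Q :: "complex poly" where
    "Q = smult (2 ^ (ep + em)) (monom 1 k * ([:1, of_nat ep:] * [:1, - of_nat em:] *
           (\<Prod>r=1..d'. [:1 + (a' r)\<^sup>2, - 2 * a' r:])))"
  define G where "G = (\<lambda>\<theta>. of_real (cos \<theta>) ^ k * density \<theta>)"
  have "degree Q \<le> k + (ep + em + d')"
    unfolding Q_def
  proof (intro order.trans[OF degree_smult_le] order.trans[OF degree_mult_le] add_mono)
    show "degree (\<Prod>r=1..d'. [:1 + (a' r)\<^sup>2, - 2 * a' r:]) \<le> d'"
      by (rule order.trans[OF degree_prod_sum_le])
         (use sum_bounded_above[of "{1..d'}" "\<lambda>r. degree [:1 + (a' r)\<^sup>2, - 2 * a' r:]" 1] in \<open>auto simp: o_def\<close>)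
  qed (use eps in \<open>auto simp: degree_monom_eq\<close>)
  then have deg: "degree Q < ?K" using assms by simp
  have G: "poly Q (of_real (cos \<theta>)) /
      (\<Prod>i\<in>{1..d} <+> {1..d'}. 1 - 2 * case_sum a a' i * of_real (cos \<theta>) + (case_sum a a' i)\<^sup>2) = G \<theta>" for \<theta>
  proof -
    let ?P = "\<Prod>r=1..d. 1 - 2 * a r * of_real (cos \<theta>) + (a r)\<^sup>2"
    let ?P' = "\<Prod>r=1..d'. 1 - 2 * a' r * of_real (cos \<theta>) + (a' r)\<^sup>2"
    have nz: "?P' \<noteq> 0"
      using quadratic_nonzero norm_a' by auto
    have "(\<Prod>r=1..d'. poly [:1 + (a' r)\<^sup>2, - 2 * a' r:] (of_real (cos \<theta>))) = ?P'"
      by (rule prod.cong) simp_all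
    moreover have "poly [:1, of_nat ep:] (complex_of_real (cos \<theta>)) = of_real (1 + real ep * cos \<theta>)"
      "poly [:1, - of_nat em:] (complex_of_real (cos \<theta>)) = of_real (1 - real em * cos \<theta>)"
      by simp_all
    ultimately have "poly Q (of_real (cos \<theta>)) = 2 ^ (ep + em) * (1 * of_real (cos \<theta>) ^ k *
        (of_real (1 + real ep * cos \<theta>) * of_real (1 - real em * cos \<theta>) * ?P'))"
      unfolding Q_def poly_smult poly_mult poly_monom poly_prod by (simp only:)
    then have "poly Q (of_real (cos \<theta>)) = of_real (cos \<theta>) ^ k *
        of_real (2 ^ (ep + em) * (1 + real ep * cos \<theta>) * (1 - real em * cos \<theta>)) * ?P'"
      by (simp only: of_real_mult of_real_power of_real_numeral mult_1 mult_ac)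
    moreover have "(\<Prod>i\<in>{1..d} <+> {1..d'}. 1 - 2 * case_sum a a' i * of_real (cos \<theta>) + (case_sum a a' i)\<^sup>2) =
        ?P * ?P'"
      by (simp add: prod.Plus o_def)
    ultimately show ?thesis
      using nz unfolding G_def density_def by simp
  qed
  from bernstein_szego_quadrature[OF deg, of "em + tm", unfolded G]
  have "(G has_integral 2 * of_real pi *
     (\<Sum>k | k \<le> ?K \<and> even (k + (em + tm)). (if k = 0 \<or> k = ?K then 1 / 2 else 1) *
        G (angle (real k)) / of_real (Phi' (angle (real k))))) {0..pi}" .
  also have "(\<Sum>k | k \<le> ?K \<and> even (k + (em + tm)). (if k = 0 \<or> k = ?K then 1 / 2 else 1) *
        G (angle (real k)) / of_real (Phi' (angle (real k)))) =
      (\<Sum>k\<in>(\<lambda>l. 2 * l + em + tm) ` {..<N}. (if k = 0 \<or> k = ?K then 1 / 2 else 1) *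
        G (angle (real k)) / of_real (Phi' (angle (real k))))"
  proof (rule sum.mono_neutral_right)
    show "(\<lambda>l. 2 * l + em + tm) ` {..<N} \<subseteq> {k. k \<le> ?K \<and> even (k + (em + tm))}"
      using N_pos by auto
    show "\<forall>k\<in>{k. k \<le> ?K \<and> even (k + (em + tm))} - (\<lambda>l. 2 * l + em + tm) ` {..<N}.
        (if k = 0 \<or> k = ?K then 1 / 2 else 1) * G (angle (real k)) / of_real (Phi' (angle (real k))) = 0"
    proof
      fix k assume k: "k \<in> {k. k \<le> ?K \<and> even (k + (em + tm))} - (\<lambda>l. 2 * l + em + tm) ` {..<N}"
      \<comment> \<open>The general rule may have nodes besides the N wanted ones, but only at the
        endpoints 0 (with em = 1) and pi (with ep = 1). There a factor 1 - cos or 1 + cos of the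
        density vanishes.\<close>
      have "(em = 1 \<and> k = 0) \<or> (ep = 1 \<and> k = ?K)"
      proof (rule ccontr)
        assume contra: "\<not> ((em = 1 \<and> k = 0) \<or> (ep = 1 \<and> k = ?K))"
        have "even (k + (em + tm))" using k by blast
        then obtain j where j: "k + (em + tm) = 2 * j" by (rule evenE)
        have cases: "em = 0 \<or> em = 1" "tm = 0 \<or> tm = 1" "ep = 0 \<or> ep = 1" "tp = 0 \<or> tp = 1"
          using eps by auto
        have "em + tm < k + 2"
          using cases(1,2) contra by auto
        moreover have "k \<le> ?K" using k by simp
        then have "k < 2 * (N - 1) + em + tm + 2"
          using cases(3,4) contra by auto
        ultimately have "k = 2 * (j - (em + tm)) + em + tm" "j - (em + tm) < N"
          using j N_pos by linarith+
        with k show False by blast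
      qed
      then have "G (angle (real k)) = 0"
      proof
        assume "em = 1 \<and> k = 0"
        then have "density 0 = 0" "angle (real k) = 0"
          unfolding density_def by (simp, metis angle_0 of_nat_0)
        then show ?thesis by (simp only: G_def mult_zero_right)
      next
        assume "ep = 1 \<and> k = ?K"
        then have "density pi = 0" "angle (real k) = pi"
          unfolding density_def by (simp, metis angle_K)
        then show ?thesis by (simp only: G_def mult_zero_right)
      qed
      then show "(if k = 0 \<or> k = ?K then 1 / 2 else 1) * G (angle (real k)) / of_real (Phi' (angle (real k))) = 0"
        by simp
    qed
  qed auto
  also have "\<dots> = (\<Sum>l<N. G (nd l) * wt l)"
  proof (subst sum.reindex, unfold o_def)
    show "inj_on (\<lambda>l. 2 * l + em + tm) {..<N}" by (auto simp: inj_on_def)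
    show "(\<Sum>l<N. (if 2 * l + em + tm = 0 \<or> 2 * l + em + tm = ?K then 1 / 2 else 1) *
        G (angle (real (2 * l + em + tm))) / of_real (Phi' (angle (real (2 * l + em + tm))))) = (\<Sum>l<N. G (nd l) * wt l)"
    proof (rule sum.cong[OF refl])
      fix l assume "l \<in> {..<N}"
      then have "l < N" by simp
      show "(if 2 * l + em + tm = 0 \<or> 2 * l + em + tm = ?K then 1 / 2 else 1) *
        G (angle (real (2 * l + em + tm))) / of_real (Phi' (angle (real (2 * l + em + tm)))) = G (nd l) * wt l"
        unfolding weight_eq weight_factor[OF \<open>l < N\<close>] node_eq
        by (simp only: times_divide_eq_right mult.commute)
    qed
  qed
  finally show ?thesis by (simp only: G_def)
qed

end

subsection \<open>Multivariate polynomials and symmetrization\<close>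

text \<open>Functions generated by monomials and sums, with an exponent bound for each variable. The
  degree of a product can be bounded without expanding it, and induction is exactly the linearity
  argument for \<open>product_quadrature\<close>.\<close>

inductive poly_function :: "nat \<Rightarrow> (nat \<Rightarrow> nat) \<Rightarrow> ((nat \<Rightarrow> complex) \<Rightarrow> complex) \<Rightarrow> bool"
  for n e where
  monomial: "(\<And>j. j \<in> {1..n} \<Longrightarrow> \<alpha> j \<le> e j) \<Longrightarrow> poly_function n e (\<lambda>x. b * (\<Prod>j=1..n. x j ^ \<alpha> j))"
| add: "poly_function n e F \<Longrightarrow> poly_function n e G \<Longrightarrow> poly_function n e (\<lambda>x. F x + G x)"

lemma poly_function_const: "poly_function n e (\<lambda>_. b)"
  using poly_function.monomial[of n "\<lambda>_. 0" e b] by simp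

lemma poly_function_sum:
  "(\<And>i. i \<in> A \<Longrightarrow> poly_function n e (F i)) \<Longrightarrow> poly_function n e (\<lambda>x. \<Sum>i\<in>A. F i x)"
  by (induction A rule: infinite_finite_induct)
     (auto intro: poly_function_const poly_function.add)

lemma poly_function_mult:
  assumes "poly_function n e F" "poly_function n e' G"
  shows "poly_function n (\<lambda>j. e j + e' j) (\<lambda>x. F x * G x)"
  using assms(1)
proof induction
  case (monomial \<alpha> b)
  from assms(2) show ?case
  proof induction
    case (monomial \<beta> b')
    have "poly_function n (\<lambda>j. e j + e' j) (\<lambda>x. (b * b') * (\<Prod>j=1..n. x j ^ (\<alpha> j + \<beta> j)))"
      using monomial \<open>\<And>j. j \<in> {1..n} \<Longrightarrow> \<alpha> j \<le> e j\<close> by (intro poly_function.monomial add_mono) auto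
    then show ?case by (simp add: power_add prod.distrib mult_ac)
  next
    case (add F G)
    then show ?case using poly_function.add by (fastforce simp: distrib_left)
  qed
next
  case (add F G)
  then show ?case using poly_function.add by (fastforce simp: distrib_right)
qed

lemma poly_function_prod:
  assumes "finite A" "\<And>i. i \<in> A \<Longrightarrow> poly_function n (e i) (F i)"
  shows "poly_function n (\<lambda>j. \<Sum>i\<in>A. e i j) (\<lambda>x. \<Prod>i\<in>A. F i x)"
  using assms
  by (induction A rule: finite_induct) (auto intro: poly_function_const poly_function_mult)

lemma poly_function_var:
  assumes "i \<in> {1..n}"
  shows "poly_function n (\<lambda>j. if j = i then 1 else 0) (\<lambda>x. x i)"
proof -
  have "(\<Prod>j=1..n. x j ^ (if j = i then 1 else 0)) = (\<Prod>j=1..n. if j = i then x j else 1)"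
    for x :: "nat \<Rightarrow> complex" by (intro prod.cong) auto
  also have "\<dots>x = x i" for x :: "nat \<Rightarrow> complex" using assms by simp
  finally show ?thesis
    using poly_function.monomial[of n "\<lambda>j. if j = i then 1 else 0" "\<lambda>j. if j = i then 1 else 0" 1]
    by simp
qed

lemma poly_function_mono:
  assumes "poly_function n e F" "\<And>j. j \<in> {1..n} \<Longrightarrow> e j \<le> e' j"
  shows "poly_function n e' F"
  using assms(1)
proof induction
  case (monomial \<alpha> b)
  show ?case using order.trans[OF monomial assms(2)] by (rule poly_function.monomial)
qed (rule poly_function.add)

lemma poly_function_diff:
  assumes "i \<in> {1..n}" "k \<in> {1..n}"
  shows "poly_function n (\<lambda>j. (if j = i then 1 else 0) + (if j = k then 1 else 0)) (\<lambda>x. x i - x k)"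
proof -
  have "poly_function n (\<lambda>j. 0 + (if j = k then 1 else 0)) (\<lambda>x. (-1) * x k)"
    by (rule poly_function_mult[OF poly_function_const poly_function_var[OF assms(2)]])
  then have "poly_function n (\<lambda>j. (if j = i then 1 else 0) + (if j = k then 1 else 0)) (\<lambda>x. (-1) * x k)"
    by (rule poly_function_mono) auto
  moreover have "poly_function n (\<lambda>j. (if j = i then 1 else 0) + (if j = k then 1 else 0)) (\<lambda>x. x i)"
    using poly_function_var[OF assms(1)] by (rule poly_function_mono) auto
  ultimately show ?thesis
    using poly_function.add by fastforce
qed

section \<open>The squared Vandermonde product\<close>

definition vandermonde_sq :: "nat \<Rightarrow> (nat \<Rightarrow> complex) \<Rightarrow> complex" where
  "vandermonde_sq n x = (\<Prod>j=1..n. \<Prod>k\<in>{j<..n}. (x j - x k)\<^sup>2)"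

lemma prod_off_diagonal:
  fixes g :: "nat \<Rightarrow> nat \<Rightarrow> 'a::comm_monoid_mult"
  shows "(\<Prod>j=1..n. \<Prod>k\<in>{1..n} - {j}. g j k) = (\<Prod>j=1..n. \<Prod>k\<in>{j<..n}. g j k * g k j)"
proof -
  have "(\<Prod>j=1..n. \<Prod>k\<in>{1..n} - {j}. g j k) = (\<Prod>j=1..n. (\<Prod>k\<in>{j<..n}. g j k) * (\<Prod>k\<in>{1..<j}. g j k))"
  proof (rule prod.cong[OF refl])
    fix j assume "j \<in> {1..n}"
    then have split: "{1..n} - {j} = {j<..n} \<union> {1..<j}" by auto
    show "(\<Prod>k\<in>{1..n} - {j}. g j k) = (\<Prod>k\<in>{j<..n}. g j k) * (\<Prod>k\<in>{1..<j}. g j k)"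
      unfolding split by (rule prod.union_disjoint) auto
  qed
  also have "\<dots> = (\<Prod>j=1..n. \<Prod>k\<in>{j<..n}. g j k) * (\<Prod>j=1..n. \<Prod>k\<in>{1..<j}. g j k)"
    by (rule prod.distrib)
  also have "(\<Prod>j=1..n. \<Prod>k\<in>{1..<j}. g j k) = (\<Prod>j=1..n. \<Prod>k | k \<in> {1..n} \<and> k < j. g j k)"
    by (intro prod.cong) auto
  also have "\<dots> = (\<Prod>k=1..n. \<Prod>j | j \<in> {1..n} \<and> k < j. g j k)"
    by (rule prod.swap_restrict) auto
  also have "\<dots> = (\<Prod>j=1..n. \<Prod>k\<in>{j<..n}. g k j)"
    by (intro prod.cong) auto
  finally show ?thesis by (simp only: prod.distrib)
qed

text \<open>The product over all ordered pairs of distinct indices is visibly invariant under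
  permutations; passing to it costs only a sign depending on n.\<close>

lemma vandermonde_sq_eq:
  "vandermonde_sq n x =
     (\<Prod>j=1..n. \<Prod>k\<in>{j<..n}. -1) * (\<Prod>j=1..n. \<Prod>k\<in>{1..n} - {j}. x j - x k)"
  unfolding vandermonde_sq_def prod_off_diagonal prod.distrib[symmetric]
  by (intro prod.cong refl) (simp add: power2_eq_square algebra_simps)

lemma vandermonde_sq_permute:
  assumes "\<sigma> permutes {1..n}"
  shows "vandermonde_sq n (\<lambda>j. x (\<sigma> j)) = vandermonde_sq n x"
proof -
  have inner: "(\<Prod>k\<in>{1..n} - {j}. x (\<sigma> j) - x (\<sigma> k)) = (\<Prod>k\<in>{1..n} - {\<sigma> j}. x (\<sigma> j) - x k)" for j
  proof (rule prod.reindex_bij_betw)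
    have "\<sigma> ` ({1..n} - {j}) = {1..n} - {\<sigma> j}"
      using assms by (simp add: image_set_diff permutes_inj permutes_image)
    then show "bij_betw \<sigma> ({1..n} - {j}) ({1..n} - {\<sigma> j})"
      using permutes_inj[OF assms] by (auto simp: bij_betw_def inj_on_def)
  qed
  have "(\<Prod>j=1..n. \<Prod>k\<in>{1..n} - {\<sigma> j}. x (\<sigma> j) - x k) = (\<Prod>j=1..n. \<Prod>k\<in>{1..n} - {j}. x j - x k)"
    using prod.permute[OF assms, of "\<lambda>j. \<Prod>k\<in>{1..n} - {j}. x j - x k"] by (simp add: o_def)
  then show ?thesis unfolding vandermonde_sq_eq inner by simp
qed

lemma vandermonde_sq_eq_0:
  assumes "\<not> inj_on x {1..n}"
  shows "vandermonde_sq n x = 0"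
proof -
  obtain j k where "j \<in> {1..n}" "k \<in> {1..n}" "j \<noteq> k" "x j = x k"
    using assms by (auto simp: inj_on_def)
  then have "(\<Prod>k\<in>{1..n} - {j}. x j - x k) = 0" by auto
  with \<open>j \<in> {1..n}\<close> have "(\<Prod>j=1..n. \<Prod>k\<in>{1..n} - {j}. x j - x k) = 0" by auto
  then show ?thesis unfolding vandermonde_sq_eq by simp
qed

lemma vandermonde_sq_cong:
  "(\<And>j. j \<in> {1..n} \<Longrightarrow> x j = y j) \<Longrightarrow> vandermonde_sq n x = vandermonde_sq n y"
  unfolding vandermonde_sq_def by (intro prod.cong refl) auto

text \<open>Each variable occurs in 2(n - 1) of the factors for ordered pairs, n - 1 times in either
  position.\<close>

lemma poly_function_vandermonde_sq: "poly_function n (\<lambda>_. 2 * (n - 1)) (vandermonde_sq n)"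
proof -
  have "poly_function n
     (\<lambda>i. \<Sum>j=1..n. \<Sum>k\<in>{1..n} - {j}. (if i = j then 1 else 0) + (if i = k then 1 else 0))
     (\<lambda>x. \<Prod>j=1..n. \<Prod>k\<in>{1..n} - {j}. x j - x k)"
    by (intro poly_function_prod poly_function_diff) auto
  then have "poly_function n (\<lambda>_. 2 * (n - 1)) (\<lambda>x. \<Prod>j=1..n. \<Prod>k\<in>{1..n} - {j}. x j - x k)"
  proof (rule poly_function_mono)
    fix i assume i: "i \<in> {1..n}"
    have "(\<Sum>j=1..n. \<Sum>k\<in>{1..n} - {j}. (if i = j then 1 else 0) + (if i = k then 1 else 0)) =
          (\<Sum>j=1..n. (if i = j then n - 1 else 0) + (if i \<noteq> j then 1 else 0 :: nat))"
      unfolding sum.distrib using i by (intro arg_cong2[of _ _ _ _ "(+)"] sum.cong) auto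
    also have "\<dots> = (n - 1) + card ({1..n} - {i})"
    proof -
      have "(\<Sum>j=1..n. if i \<noteq> j then 1 else 0 :: nat) = (\<Sum>j\<in>{1..n} - {i}. 1)"
        by (rule sum.mono_neutral_cong_right) auto
      then show ?thesis unfolding sum.distrib using i by simp
    qed
    also have "\<dots> = 2 * (n - 1)" using i by simp
    finally show "(\<Sum>j=1..n. \<Sum>k\<in>{1..n} - {j}. (if i = j then 1 else 0) + (if i = k then 1 else 0)) \<le> 2 * (n - 1)"
      by simp
  qed
  from poly_function_mult[OF poly_function_const[of n "\<lambda>_. 0"] this]
  show ?thesis unfolding vandermonde_sq_eq by simp
qed

section \<open>Evaluation of symmetric polynomials\<close>

lemma poly_eval_eq:
  assumes "f \<in> symmetric_polys D n"
  shows "poly_eval f x = (\<Sum>\<alpha>\<in>Poly_Mapping.keys f. Poly_Mapping.lookup f \<alpha> * (\<Prod>j=1..n. x j ^ Poly_Mapping.lookup \<alpha> j))"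
  unfolding poly_eval_def
proof (intro sum.cong refl arg_cong2[of _ _ _ _ "(*)"])
  fix \<alpha> assume "\<alpha> \<in> Poly_Mapping.keys f"
  then have "Poly_Mapping.keys \<alpha> \<subseteq> {1..n}" using assms by (auto simp: symmetric_polys_def)
  then show "(\<Prod>j\<in>Poly_Mapping.keys \<alpha>. x j ^ Poly_Mapping.lookup \<alpha> j) = (\<Prod>j=1..n. x j ^ Poly_Mapping.lookup \<alpha> j)"
    by (intro prod.mono_neutral_left) (auto simp: in_keys_iff)
qed

lemma poly_eval_cong:
  assumes "f \<in> symmetric_polys D n" "\<And>j. j \<in> {1..n} \<Longrightarrow> x j = y j"
  shows "poly_eval f x = poly_eval f y"
  unfolding poly_eval_eq[OF assms(1)] using assms(2) by (intro sum.cong refl arg_cong2[of _ _ _ _ "(*)"] prod.cong) auto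

lemma poly_function_poly_eval:
  assumes "f \<in> symmetric_polys D n"
  shows "poly_function n (\<lambda>_. nat D) (poly_eval f)"
  unfolding poly_eval_eq[OF assms]
proof (intro poly_function_sum poly_function.monomial)
  fix \<alpha> j assume "\<alpha> \<in> Poly_Mapping.keys f" "j \<in> {1..n}"
  then have "int (Poly_Mapping.lookup \<alpha> j) \<le> D" using assms unfolding symmetric_polys_def by blast
  then show "Poly_Mapping.lookup \<alpha> j \<le> nat D" by linarith
qed

text \<open>Composition with \<sigma> is injective on exponent vectors and preserves coefficients,
  hence permutes the finite support. After reindexing, exponents and variables carry the same
  permutation, which disappears from the product.\<close>

lemma poly_eval_permute:
  assumes f: "f \<in> symmetric_polys D n" and \<sigma>: "\<sigma> permutes {1..n}"
  shows "poly_eval f (\<lambda>j. x (\<sigma> j)) = poly_eval f x"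
proof -
  let ?k = "Poly_Mapping.map_key \<sigma> :: (nat \<Rightarrow>\<^sub>0 nat) \<Rightarrow> nat \<Rightarrow>\<^sub>0 nat" and ?l = Poly_Mapping.lookup
  have lookup: "?l (?k \<alpha>) j = ?l \<alpha> (\<sigma> j)" for \<alpha> :: "nat \<Rightarrow>\<^sub>0 nat" and j
    by (simp add: map_key.rep_eq[OF permutes_inj[OF \<sigma>]])
  have f': "?l f (?k \<alpha>) = ?l f \<alpha>" for \<alpha> using f \<sigma> by (simp add: symmetric_polys_def)
  have inj: "inj ?k"
  proof (rule injI)
    fix \<alpha> \<beta> :: "nat \<Rightarrow>\<^sub>0 nat" assume "?k \<alpha> = ?k \<beta>"
    then have "?l \<alpha> (\<sigma> j) = ?l \<beta> (\<sigma> j)" for j by (metis lookup)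
    then show "\<alpha> = \<beta>" using permutes_surj[OF \<sigma>] by (intro poly_mapping_eqI) (metis surjD)
  qed
  have "?k ` Poly_Mapping.keys f = Poly_Mapping.keys f"
  proof (rule card_subset_eq)
    show "?k ` Poly_Mapping.keys f \<subseteq> Poly_Mapping.keys f" by (auto simp: in_keys_iff f')
  qed (use inj in \<open>auto intro: card_image inj_on_subset\<close>)
  then have bij: "bij_betw ?k (Poly_Mapping.keys f) (Poly_Mapping.keys f)"
    using inj by (auto simp: bij_betw_def intro: inj_on_subset)
  have *: "poly_eval f x = (\<Sum>\<alpha>\<in>Poly_Mapping.keys f. ?l f \<alpha> * (\<Prod>j=1..n. x j ^ ?l \<alpha> (\<sigma> j)))" for x
    unfolding poly_eval_eq[OF f]
    by (subst sum.reindex_bij_betw[OF bij, symmetric]) (simp only: f' lookup)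
  have "(\<Prod>j=1..n. x (\<sigma> j) ^ ?l \<alpha> (\<sigma> j)) = (\<Prod>j=1..n. x j ^ ?l \<alpha> j)" for \<alpha>
    using prod.permute[OF \<sigma>, of "\<lambda>j. x j ^ ?l \<alpha> j"] by (simp add: o_def)
  then show ?thesis
    unfolding *[of "\<lambda>j. x (\<sigma> j)"] poly_eval_eq[OF f, of x] by simp
qed

text \<open>Both sides are linear in F. For a monomial the integral splits into one-variable
  integrals, and the product of sums expands into a sum over tuples. Integrability is carried along
  for the additivity of the integral.\<close>

lemma product_quadrature:
  fixes h :: "real \<Rightarrow> complex" and x :: "nat \<Rightarrow> real" and w :: "nat \<Rightarrow> complex"
  assumes F: "poly_function n e F" and E: "\<And>j. j \<in> {1..n} \<Longrightarrow> e j \<le> E"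
    and h: "continuous_on {0..pi} h"
    and quad: "\<And>k. k \<le> E \<Longrightarrow> ((\<lambda>\<theta>. of_real (cos \<theta>) ^ k * h \<theta>) has_integral
                 2 * of_real pi * (\<Sum>l<N. of_real (cos (x l)) ^ k * h (x l) * w l)) {0..pi}"
  defines "H \<equiv> \<lambda>\<xi>. F (\<lambda>j. of_real (cos (\<xi> j))) * (\<Prod>j=1..n. h (\<xi> j))"
  shows "set_integrable (\<Pi>\<^sub>M j\<in>{1..n}. lborel) ({1..n} \<rightarrow>\<^sub>E {0..pi}) H \<and>
    (LINT \<xi>:({1..n} \<rightarrow>\<^sub>E {0..pi})|(\<Pi>\<^sub>M j\<in>{1..n}. lborel). H \<xi>) =
      (2 * of_real pi) ^ n * (\<Sum>l\<in>{1..n} \<rightarrow>\<^sub>E {..<N}. H (\<lambda>j. x (l j)) * (\<Prod>j=1..n. w (l j)))"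
  using F unfolding H_def
proof induction
  case (monomial \<alpha> b)
  interpret product_sigma_finite "\<lambda>j :: nat. lborel :: real measure" ..
  define g where "g j \<theta> = of_real (cos \<theta>) ^ \<alpha> j * h \<theta>" for j \<theta>
  define S where "S = ({1..n} \<rightarrow>\<^sub>E {0..pi})"
  define M where "M = (\<Pi>\<^sub>M j\<in>{1..n}. lborel :: real measure)"
  have g_cont: "continuous_on {0..pi} (g j)" for j
    unfolding g_def by (intro continuous_intros h)
  then have g_int: "set_integrable lborel {0..pi} (g j)" for j
    by (rule borel_integrable_atLeastAtMost')
  have g_quad: "(LINT \<theta>:{0..pi}|lborel. g j \<theta>) = 2 * of_real pi * (\<Sum>l<N. g j (x l) * w l)" if "j \<in> {1..n}" for j
  proof -
    have "\<alpha> j \<le> E" using monomial[OF that] E[OF that] by simp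
    moreover have "g j = (\<lambda>\<theta>. of_real (cos \<theta>) ^ \<alpha> j * h \<theta>)"
      by (rule ext) (simp add: g_def)
    ultimately show ?thesis
      unfolding set_borel_integral_eq_integral(2)[OF g_int] using integral_unique[OF quad] by simp
  qed
  have split: "b * (\<Prod>j=1..n. of_real (cos (\<xi> j)) ^ \<alpha> j) * (\<Prod>j=1..n. h (\<xi> j)) = b * (\<Prod>j=1..n. g j (\<xi> j))" for \<xi>
    by (simp add: g_def prod.distrib)
  \<comment> \<open>Points of the product space are extensional, so one outside the cube has a
    coordinate outside [0, pi], and both sides vanish.\<close>
  have ind: "indicator S \<xi> *\<^sub>R (b * (\<Prod>j=1..n. g j (\<xi> j))) = b * (\<Prod>j=1..n. indicator {0..pi} (\<xi> j) *\<^sub>R g j (\<xi> j))"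
    if "\<xi> \<in> space M" for \<xi>
  proof (cases "\<xi> \<in> S")
    case True
    then have "\<xi> j \<in> {0..pi}" if "j \<in> {1..n}" for j using that unfolding S_def by (rule PiE_mem)
    then show ?thesis using True by simp
  next
    case False
    moreover have "\<xi> \<in> extensional {1..n}"
      using that by (simp add: M_def space_PiM PiE_iff)
    ultimately obtain j where j: "j \<in> {1..n}" "\<xi> j \<notin> {0..pi}"
      unfolding S_def PiE_iff by blast
    then have "(\<Prod>j=1..n. indicator {0..pi} (\<xi> j) *\<^sub>R g j (\<xi> j)) = 0"
      by (intro prod_zero bexI[of _ j]) auto
    with False show ?thesis by simp
  qed
  have int: "integrable M (\<lambda>\<xi>. b * (\<Prod>j=1..n. indicator {0..pi} (\<xi> j) *\<^sub>R g j (\<xi> j)))"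
    unfolding M_def using g_int
    by (intro integrable_mult_right product_integrable_prod) (auto simp: set_integrable_def)
  have "set_integrable M S (\<lambda>\<xi>. b * (\<Prod>j=1..n. g j (\<xi> j)))"
    unfolding set_integrable_def using int by (subst Bochner_Integration.integrable_cong[OF refl ind])
  moreover have "(LINT \<xi>:S|M. b * (\<Prod>j=1..n. g j (\<xi> j))) =
      (2 * of_real pi) ^ n * (\<Sum>l\<in>{1..n} \<rightarrow>\<^sub>E {..<N}. b * (\<Prod>j=1..n. g j (x (l j))) * (\<Prod>j=1..n. w (l j)))"
  proof -
    have "(LINT \<xi>:S|M. b * (\<Prod>j=1..n. g j (\<xi> j))) =
        (LINT \<xi>|M. b * (\<Prod>j=1..n. indicator {0..pi} (\<xi> j) *\<^sub>R g j (\<xi> j)))"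
      unfolding set_lebesgue_integral_def using ind by (intro Bochner_Integration.integral_cong) auto
    also have "\<dots> = b * (\<Prod>j=1..n. LINT \<theta>|lborel. indicator {0..pi} \<theta> *\<^sub>R g j \<theta>)"
      unfolding M_def using g_int
      by (subst integral_mult_right_zero, subst product_integral_prod) (auto simp: set_integrable_def)
    also have "\<dots> = b * (\<Prod>j=1..n. 2 * of_real pi * (\<Sum>l<N. g j (x l) * w l))"
      using g_quad unfolding set_lebesgue_integral_def by simp
    also have "\<dots> = b * ((2 * of_real pi) ^ n * (\<Prod>j=1..n. \<Sum>l<N. g j (x l) * w l))"
      by (simp only: prod.distrib prod_constant card_atLeastAtMost add_diff_cancel_right' Suc_eq_plus1
          power_mult_distrib)
    also have "(\<Prod>j=1..n. \<Sum>l<N. g j (x l) * w l) = (\<Sum>l\<in>{1..n} \<rightarrow>\<^sub>E {..<N}. \<Prod>j=1..n. g j (x (l j)) * w (l j))"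
      by (rule prod_sum_PiE) auto
    finally show ?thesis
      by (simp add: sum_distrib_left prod.distrib mult_ac)
  qed
  ultimately show ?case unfolding split S_def M_def by simp
next
  case (add F G)
  note F = add.IH(1)[THEN conjunct1] add.IH(1)[THEN conjunct2]
    and G = add.IH(2)[THEN conjunct1] add.IH(2)[THEN conjunct2]
  show ?case
    unfolding distrib_right sum.distrib distrib_left F(2)[symmetric] G(2)[symmetric]
    by (intro conjI set_integral_add F(1) G(1))
qed

section \<open>Tuples with distinct entries and decreasing sequences\<close>

lemma strictly_decreasing_gap:
  fixes L :: "nat \<Rightarrow> nat"
  assumes "\<And>i j. \<lbrakk>i \<in> {1..n}; j \<in> {1..n}; i < j\<rbrakk> \<Longrightarrow> L j < L i" "1 \<le> i" "i \<le> j" "j \<le> n"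
  shows "L j + (j - i) \<le> L i"
  using assms(3,4)
proof (induction j rule: dec_induct)
  case (step j)
  then have "L (Suc j) < L j" using assms(1,2) by auto
  with step show ?case by auto
qed simp

text \<open>
  An injective \<open>l\<close> arises from a unique strictly decreasing sequence \<open>j \<mapsto> \<mu>\<^sub>j + n - j\<close> by a unique
  rearrangement \<open>\<sigma>\<close>, where \<open>\<sigma> j\<close> is the rank of \<open>l j\<close> among the values of \<open>l\<close> in decreasing order.
\<close>

lemma bij_betw_index_set_permutations:
  "bij_betw (\<lambda>(\<mu>, \<sigma>). \<lambda>j\<in>{1..n}. \<mu> (\<sigma> j) + (n - \<sigma> j))
     (index_set m n \<times> {\<sigma>. \<sigma> permutes {1..n}})
     {l \<in> {1..n} \<rightarrow>\<^sub>E {..<m + n}. inj_on l {1..n}}"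
proof -
  define L where "L \<mu> j = \<mu> j + (n - j)" for \<mu> :: "nat \<Rightarrow> nat" and j
  have L_less: "L \<mu> j < L \<mu> i" if "\<mu> \<in> index_set m n" "i \<in> {1..n}" "j \<in> {1..n}" "i < j" for \<mu> i j
  proof -
    have "\<mu> j \<le> \<mu> i" using that by (auto simp: index_set_def)
    with that show ?thesis by (auto simp: L_def)
  qed
  have L_inj: "inj_on (L \<mu>) {1..n}" if "\<mu> \<in> index_set m n" for \<mu>
  proof (rule inj_onI)
    fix i j assume "i \<in> {1..n}" "j \<in> {1..n}" "L \<mu> i = L \<mu> j"
    then show "i = j"
      using L_less[OF that, of i j] L_less[OF that, of j i] by (metis less_irrefl linorder_neqE_nat)
  qed
  have L_bound: "L \<mu> j < m + n" if "\<mu> \<in> index_set m n" "j \<in> {1..n}" for \<mu> j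
  proof -
    have "\<mu> j \<le> m" using that by (auto simp: index_set_def)
    with that show ?thesis by (auto simp: L_def)
  qed
  \<comment> \<open>As \<open>L \<mu>\<close> decreases strictly, the values not below
    \<open>L \<mu> (\<sigma> j)\<close> are those at 1, ..., \<open>\<sigma> j\<close>. So the tuple
    determines \<open>\<sigma>\<close>, which gives injectivity.\<close>
  have rank: "card {v \<in> (\<lambda>j. L \<mu> (\<sigma> j)) ` {1..n}. L \<mu> (\<sigma> j) \<le> v} = \<sigma> j"
    if \<mu>: "\<mu> \<in> index_set m n" and \<sigma>: "\<sigma> permutes {1..n}" and j: "j \<in> {1..n}" for \<mu> \<sigma> j
  proof -
    have "(\<lambda>j. L \<mu> (\<sigma> j)) ` {1..n} = L \<mu> ` {1..n}"
      using permutes_image[OF \<sigma>] by (metis image_image)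
    moreover have \<sigma>j: "\<sigma> j \<in> {1..n}" using \<sigma> j by (simp only: permutes_in_image)
    have "{v \<in> L \<mu> ` {1..n}. L \<mu> (\<sigma> j) \<le> v} = L \<mu> ` {1..\<sigma> j}"
    proof (intro set_eqI iffI)
      fix v assume "v \<in> {v \<in> L \<mu> ` {1..n}. L \<mu> (\<sigma> j) \<le> v}"
      then obtain i where i: "i \<in> {1..n}" "v = L \<mu> i" "L \<mu> (\<sigma> j) \<le> L \<mu> i" by auto
      then have "\<not> \<sigma> j < i" using L_less[OF \<mu> \<sigma>j i(1)] by auto
      with i show "v \<in> L \<mu> ` {1..\<sigma> j}" by auto
    next
      fix v assume "v \<in> L \<mu> ` {1..\<sigma> j}"
      then obtain i where i: "1 \<le> i" "i \<le> \<sigma> j" "v = L \<mu> i" by auto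
      then have "i \<in> {1..n}" using \<sigma>j by auto
      moreover have "L \<mu> (\<sigma> j) \<le> L \<mu> i"
        using i L_less[OF \<mu> \<open>i \<in> {1..n}\<close> \<sigma>j] by (cases "i = \<sigma> j") auto
      ultimately show "v \<in> {v \<in> L \<mu> ` {1..n}. L \<mu> (\<sigma> j) \<le> v}" using i by auto
    qed
    moreover have "card (L \<mu> ` {1..\<sigma> j}) = \<sigma> j"
      using inj_on_subset[OF L_inj[OF \<mu>], of "{1..\<sigma> j}"] \<sigma>j by (simp add: card_image)
    ultimately show ?thesis by simp
  qed
  define \<Phi> where "\<Phi> = (\<lambda>(\<mu>, \<sigma>). \<lambda>j\<in>{1..n}. L \<mu> (\<sigma> j))"
  have "bij_betw \<Phi> (index_set m n \<times> {\<sigma>. \<sigma> permutes {1..n}})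
     {l \<in> {1..n} \<rightarrow>\<^sub>E {..<m + n}. inj_on l {1..n}}"
    unfolding bij_betw_def
  proof (intro conjI set_eqI iffI)
    show "inj_on \<Phi> (index_set m n \<times> {\<sigma>. \<sigma> permutes {1..n}})"
    proof (rule inj_onI, clarify)
      fix \<mu> \<sigma> \<mu>' \<sigma>'
      assume \<mu>: "\<mu> \<in> index_set m n" "\<mu>' \<in> index_set m n" and \<sigma>: "\<sigma> permutes {1..n}" "\<sigma>' permutes {1..n}"
        and eq: "\<Phi> (\<mu>, \<sigma>) = \<Phi> (\<mu>', \<sigma>')"
      have eq': "L \<mu> (\<sigma> j) = L \<mu>' (\<sigma>' j)" if "j \<in> {1..n}" for j
        using fun_cong[OF eq, of j] that by (simp add: \<Phi>_def)
      then have im: "(\<lambda>j. L \<mu> (\<sigma> j)) ` {1..n} = (\<lambda>j. L \<mu>' (\<sigma>' j)) ` {1..n}" by (rule image_cong[OF refl])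
      have \<sigma>_eq: "\<sigma> = \<sigma>'"
      proof
        fix j show "\<sigma> j = \<sigma>' j"
        proof (cases "j \<in> {1..n}")
          case True
          show ?thesis
            using rank[OF \<mu>(1) \<sigma>(1) True] rank[OF \<mu>(2) \<sigma>(2) True] eq'[OF True] im by simp
        next
          case False
          then show ?thesis using \<sigma> by (simp add: permutes_not_in)
        qed
      qed
      moreover have "\<mu> = \<mu>'"
      proof (rule PiE_ext)
        show "\<mu> \<in> {1..n} \<rightarrow>\<^sub>E {0..m}" "\<mu>' \<in> {1..n} \<rightarrow>\<^sub>E {0..m}" using \<mu> by (auto simp: index_set_def)
        fix i assume i: "i \<in> {1..n}"
        then obtain j where "j \<in> {1..n}" "i = \<sigma> j" using permutes_image[OF \<sigma>(1)] by blast
        then show "\<mu> i = \<mu>' i" using eq'[of j] \<sigma>_eq by (simp add: L_def)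
      qed
      ultimately show "\<mu> = \<mu>' \<and> \<sigma> = \<sigma>'" by simp
    qed
  next
    fix l assume "l \<in> \<Phi> ` (index_set m n \<times> {\<sigma>. \<sigma> permutes {1..n}})"
    then obtain \<mu> \<sigma> where \<mu>: "\<mu> \<in> index_set m n" and \<sigma>: "\<sigma> permutes {1..n}" and l: "l = (\<lambda>j\<in>{1..n}. L \<mu> (\<sigma> j))"
      by (auto simp: \<Phi>_def)
    have \<sigma>_in: "\<sigma> j \<in> {1..n}" if "j \<in> {1..n}" for j using \<sigma> that by (simp only: permutes_in_image)
    have "l \<in> {1..n} \<rightarrow>\<^sub>E {..<m + n}"
      unfolding l using L_bound[OF \<mu> \<sigma>_in] by auto
    moreover have "inj_on l {1..n}"
    proof (rule inj_onI)
      fix i j assume ij: "i \<in> {1..n}" "j \<in> {1..n}" "l i = l j"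
      then have "\<sigma> i = \<sigma> j"
        using inj_onD[OF L_inj[OF \<mu>] _ \<sigma>_in \<sigma>_in] by (simp add: l)
      then show "i = j" using permutes_inj[OF \<sigma>] by (simp add: inj_eq)
    qed
    ultimately show "l \<in> {l \<in> {1..n} \<rightarrow>\<^sub>E {..<m + n}. inj_on l {1..n}}" by simp
  next
    fix l assume "l \<in> {l \<in> {1..n} \<rightarrow>\<^sub>E {..<m + n}. inj_on l {1..n}}"
    then have l: "l \<in> {1..n} \<rightarrow>\<^sub>E {..<m + n}" "inj_on l {1..n}" by auto
    \<comment> \<open>The rank on \<open>{1..n}\<close> and the identity elsewhere, as
      \<open>permutes\<close> demands.\<close>
    define \<sigma> where "\<sigma> j = (if j \<in> {1..n} then card {v \<in> l ` {1..n}. l j \<le> v} else j)" for j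
    have \<sigma>_less: "\<sigma> i < \<sigma> j" if "i \<in> {1..n}" "j \<in> {1..n}" "l j < l i" for i j
    proof -
      have "{v \<in> l ` {1..n}. l i \<le> v} \<subset> {v \<in> l ` {1..n}. l j \<le> v}"
        using that by (intro psubsetI) (auto dest: less_le_trans)
      then show ?thesis using that unfolding \<sigma>_def by (simp add: psubset_card_mono)
    qed
    have \<sigma>_inj: "inj_on \<sigma> {1..n}"
    proof (rule inj_onI)
      fix i j assume ij: "i \<in> {1..n}" "j \<in> {1..n}" "\<sigma> i = \<sigma> j"
      then have "l i = l j" using \<sigma>_less[of i j] \<sigma>_less[of j i] by (metis less_irrefl linorder_neqE_nat)
      then show "i = j" using l(2) ij by (auto dest: inj_onD)
    qed
    have "\<sigma> ` {1..n} \<subseteq> {1..n}"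
    proof
      fix k assume "k \<in> \<sigma> ` {1..n}"
      then obtain j where j: "j \<in> {1..n}" "k = card {v \<in> l ` {1..n}. l j \<le> v}" by (auto simp: \<sigma>_def)
      have "card {v \<in> l ` {1..n}. l j \<le> v} \<le> card (l ` {1..n})" by (intro card_mono) auto
      also have "\<dots> \<le> n" using card_image_le[of "{1..n}" l] by simp
      finally have "k \<le> n" using j by simp
      moreover have "l j \<in> {v \<in> l ` {1..n}. l j \<le> v}" using j by auto
      then have "k > 0" unfolding j(2) by (subst card_gt_0_iff) auto
      ultimately show "k \<in> {1..n}" by simp
    qed
    with \<sigma>_inj have "\<sigma> ` {1..n} = {1..n}" by (intro endo_inj_surj) auto
    with \<sigma>_inj have \<sigma>: "\<sigma> permutes {1..n}"
      by (intro bij_imp_permutes) (auto simp: bij_betw_def \<sigma>_def)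
    define L' where "L' i = l (inv \<sigma> i)" for i
    have inv_in: "inv \<sigma> i \<in> {1..n}" if "i \<in> {1..n}" for i
      using permutes_inv[OF \<sigma>] that by (simp only: permutes_in_image)
    have L'_less: "L' j < L' i" if ij: "i \<in> {1..n}" "j \<in> {1..n}" "i < j" for i j
    proof (rule ccontr)
      assume "\<not> L' j < L' i"
      moreover have "L' i \<noteq> L' j"
        using inj_onD[OF l(2) _ inv_in inv_in, of i j] ij permutes_inverses(1)[OF \<sigma>] unfolding L'_def by (metis less_irrefl)
      ultimately have "\<sigma> (inv \<sigma> j) < \<sigma> (inv \<sigma> i)"
        using \<sigma>_less[OF inv_in[OF ij(2)] inv_in[OF ij(1)]] by (simp add: L'_def)
      then show False using ij permutes_inverses(1)[OF \<sigma>] by simp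
    qed
    \<comment> \<open>Removing the staircase n - i turns strict into weak decrease. By
      \<open>L'_ge\<close> the subtraction does not truncate, and \<open>L'_le\<close> gives the
      upper bound m.\<close>
    define \<mu> where "\<mu> = (\<lambda>i\<in>{1..n}. L' i - (n - i))"
    have L'_ge: "n - i \<le> L' i" if "i \<in> {1..n}" for i
      using strictly_decreasing_gap[of n L' i n] L'_less that by auto
    have L'_le: "L' i \<le> m + (n - i)" if "i \<in> {1..n}" for i
    proof -
      have "L' 1 < m + n"
        unfolding L'_def using PiE_mem[OF l(1) inv_in[of 1]] that by auto
      moreover have "L' i + (i - 1) \<le> L' 1"
        using strictly_decreasing_gap[of n L' 1 i] L'_less that by auto
      ultimately show ?thesis using that by auto
    qed
    have L_\<mu>: "L \<mu> i = L' i" if "i \<in> {1..n}" for i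
      using L'_ge[OF that] that by (simp add: L_def \<mu>_def)
    have "\<mu> \<in> index_set m n"
      unfolding index_set_def
    proof (intro CollectI conjI ballI impI)
      show "\<mu> \<in> {1..n} \<rightarrow>\<^sub>E {0..m}"
        using L'_le by (force simp: \<mu>_def)
      fix i j assume ij: "i \<in> {1..n}" "j \<in> {1..n}" "i \<le> j"
      then have "L' j + (j - i) \<le> L' i"
        using strictly_decreasing_gap[of n L' i j] L'_less by auto
      then show "\<mu> j \<le> \<mu> i" using ij by (auto simp: \<mu>_def)
    qed
    moreover have "\<Phi> (\<mu>, \<sigma>) = l"
    proof (rule PiE_ext[OF _ l(1)])
      have \<sigma>_in: "\<sigma> j \<in> {1..n}" if "j \<in> {1..n}" for j using \<sigma> that by (simp only: permutes_in_image)
      show eq: "\<Phi> (\<mu>, \<sigma>) j = l j" if "j \<in> {1..n}" for j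
        using L_\<mu>[OF \<sigma>_in[OF that]] that permutes_inverses(2)[OF \<sigma>] by (simp add: \<Phi>_def L'_def)
      show "\<Phi> (\<mu>, \<sigma>) \<in> {1..n} \<rightarrow>\<^sub>E {..<m + n}"
        using eq PiE_mem[OF l(1)] by (auto simp: \<Phi>_def PiE_iff)
    qed
    ultimately show "l \<in> \<Phi> ` (index_set m n \<times> {\<sigma>. \<sigma> permutes {1..n}})"
      using \<sigma> by (metis (mono_tags, lifting) image_eqI mem_Collect_eq mem_Sigma_iff)
  qed
  then show ?thesis unfolding \<Phi>_def L_def .
qed

text \<open>The assumption \<open>cong\<close> mediates between the extensional tuples being summed
  over and the total functions on which permutations act. By symmetry the permutation component of
  the bijection contributes only the factor n!.\<close>

lemma sum_symmetric_eq_sum_index_set: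
  fixes \<Psi> :: "(nat \<Rightarrow> nat) \<Rightarrow> 'a::{comm_semiring_1, semiring_char_0}"
  assumes sym: "\<And>\<sigma> l. \<sigma> permutes {1..n} \<Longrightarrow> \<Psi> (\<lambda>j. l (\<sigma> j)) = \<Psi> l"
    and cong: "\<And>l l'. (\<And>j. j \<in> {1..n} \<Longrightarrow> l j = l' j) \<Longrightarrow> \<Psi> l = \<Psi> l'"
    and non_inj: "\<And>l. \<not> inj_on l {1..n} \<Longrightarrow> \<Psi> l = 0"
  shows "(\<Sum>l\<in>{1..n} \<rightarrow>\<^sub>E {..<m + n}. \<Psi> l) = fact n * (\<Sum>\<mu>\<in>index_set m n. \<Psi> (\<lambda>j. \<mu> j + (n - j)))"
proof -
  have "(\<Sum>l\<in>{1..n} \<rightarrow>\<^sub>E {..<m + n}. \<Psi> l) = (\<Sum>l | l \<in> {1..n} \<rightarrow>\<^sub>E {..<m + n} \<and> inj_on l {1..n}. \<Psi> l)"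
    by (rule sum.mono_neutral_right) (auto intro: finite_PiE non_inj)
  also have "\<dots> = (\<Sum>(\<mu>, \<sigma>)\<in>index_set m n \<times> {\<sigma>. \<sigma> permutes {1..n}}. \<Psi> (\<lambda>j\<in>{1..n}. \<mu> (\<sigma> j) + (n - \<sigma> j)))"
    by (subst sum.reindex_bij_betw[OF bij_betw_index_set_permutations, symmetric])
       (simp add: case_prod_unfold)
  also have "\<dots> = (\<Sum>(\<mu>, \<sigma>)\<in>index_set m n \<times> {\<sigma>. \<sigma> permutes {1..n}}. \<Psi> (\<lambda>j. \<mu> j + (n - j)))"
  proof (rule sum.cong[OF refl], clarify)
    fix \<mu> \<sigma> assume "\<sigma> permutes {1..n}"
    then have "\<Psi> (\<lambda>j. \<mu> (\<sigma> j) + (n - \<sigma> j)) = \<Psi> (\<lambda>j. \<mu> j + (n - j))"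
      by (rule sym[where l = "\<lambda>j. \<mu> j + (n - j)"])
    moreover have "\<Psi> (\<lambda>j\<in>{1..n}. \<mu> (\<sigma> j) + (n - \<sigma> j)) = \<Psi> (\<lambda>j. \<mu> (\<sigma> j) + (n - \<sigma> j))"
      by (rule cong) simp
    ultimately show "\<Psi> (\<lambda>j\<in>{1..n}. \<mu> (\<sigma> j) + (n - \<sigma> j)) = \<Psi> (\<lambda>j. \<mu> j + (n - j))" by simp
  qed
  also have "\<dots> = (\<Sum>\<mu>\<in>index_set m n. \<Sum>\<sigma> | \<sigma> permutes {1..n}. \<Psi> (\<lambda>j. \<mu> j + (n - j)))"
    by (rule sum.cartesian_product[symmetric])
  also have "\<dots> = fact n * (\<Sum>\<mu>\<in>index_set m n. \<Psi> (\<lambda>j. \<mu> j + (n - j)))"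
    by (simp add: card_permutations[OF refl] sum_distrib_left)
  finally show ?thesis .
qed

subsection \<open>The cubature rule\<close>

theorem theorem2:
  fixes n m d d' ep em tp tm :: nat
    and a a' :: "nat \<Rightarrow> complex"
    and f :: cpoly
    and R :: "(nat \<Rightarrow> real) \<Rightarrow> complex"
  assumes "n \<ge> 1"
    and "ep \<in> {0, 1}" and "em \<in> {0, 1}" and "tp \<in> {0, 1}" and "tm \<in> {0, 1}"
    and "\<And>r. r \<in> {1..d} \<Longrightarrow> norm (a r) < 1"
    and "\<And>r. r \<in> {1..d'} \<Longrightarrow> norm (a' r) < 1"
    and "conjugate_pairs d a" and "conjugate_pairs d' a'"
    and "int m + int n - 1 > \<lceil>half_excess d ep em\<rceil> + \<lceil>half_excess d' tp tm\<rceil>"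
    and "f \<in> symmetric_polys (2 * int m + int tp + int tm - int d' - 1) n"
    and "\<And>\<xi>. R \<xi> = poly_eval f (\<lambda>j. of_real (cos (\<xi> j))) /
           (\<Prod>r=1..d. \<Prod>j=1..n. 1 - 2 * a r * of_real (cos (\<xi> j)) + (a r)\<^sup>2)"
  shows "1 / ((2 * of_real pi) ^ n * fact n) *
           (LINT \<xi>:({1..n} \<rightarrow>\<^sub>E {0..pi})|(\<Pi>\<^sub>M j\<in>{1..n}. lborel).
              R \<xi> * of_real (jacobi_density n ep em \<xi>)) =
         (\<Sum>\<mu>\<in>index_set m n.
            R (multi_node m n ep em d a tp tm d' a' \<mu>) *
            of_real (jacobi_density n ep em (multi_node m n ep em d a tp tm d' a' \<mu>)) *
            multi_weight m n ep em d a tp tm d' a' \<mu>)"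
proof -
  define D where "D = 2 * int m + int tp + int tm - int d' - 1"
  have f: "f \<in> symmetric_polys D n" using assms(11) by (simp only: D_def)
  show ?thesis
  proof (cases "D < 0")
    \<comment> \<open>For negative D the bound \<open>nat D\<close> would be too large. Since n >=
      1, no exponent vector is admissible, so f vanishes and both sides are 0.\<close>
    case True
    have "Poly_Mapping.keys f = {}"
    proof (rule equals0I)
      fix \<alpha> assume "\<alpha> \<in> Poly_Mapping.keys f"
      then have "int (Poly_Mapping.lookup \<alpha> 1) \<le> D"
        using f assms(1) unfolding symmetric_polys_def by auto
      with True show False by linarith
    qed
    then have "R \<xi> = 0" for \<xi> by (simp add: assms(12) poly_eval_def)
    then show ?thesis by (simp add: set_lebesgue_integral_def)
  next
    case False
    interpret jacobi_quadrature "m + n" ep em d tp tm d' a a'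
    proof
      \<comment> \<open>Each number is at most its ceiling; doubling the resulting inequality says
        that there are fewer than K parameters.\<close>
      have "half_excess d ep em + half_excess d' tp tm < real m + real n - 1"
        using assms(10) le_of_int_ceiling[of "half_excess d ep em"]
          le_of_int_ceiling[of "half_excess d' tp tm"] by linarith
      then show "d + d' < 2 * (m + n - 1) + ep + em + tp + tm"
        using assms(1) by (simp add: half_excess_def field_simps)
    qed (use assms in auto)
    define F where "F y = poly_eval f y * vandermonde_sq n y" for y
    define H where "H \<xi> = F (\<lambda>j. of_real (cos (\<xi> j))) * (\<Prod>j=1..n. density (\<xi> j))" for \<xi> :: "nat \<Rightarrow> real"
    have R: "R \<xi> * of_real (jacobi_density n ep em \<xi>) = H \<xi>" for \<xi>
    proof -
      have "(\<Prod>j=1..n. density (\<xi> j)) =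
          of_real (\<Prod>j=1..n. 2 ^ (ep + em) * (1 + real ep * cos (\<xi> j)) * (1 - real em * cos (\<xi> j))) /
          (\<Prod>r=1..d. \<Prod>j=1..n. 1 - 2 * a r * of_real (cos (\<xi> j)) + (a r)\<^sup>2)"
        unfolding density_def prod_dividef of_real_prod
        by (rule arg_cong2[of _ _ _ _ "(/)"]) (rule refl, rule prod.swap)
      moreover have "vandermonde_sq n (\<lambda>j. of_real (cos (\<xi> j))) =
          of_real (\<Prod>j=1..n. \<Prod>k\<in>{j<..n}. (cos (\<xi> j) - cos (\<xi> k))\<^sup>2)"
        by (simp add: vandermonde_sq_def)
      ultimately show ?thesis
        unfolding H_def F_def assms(12) jacobi_density_def of_real_mult by simp
    qed
    have H_cong: "H \<xi> = H \<eta>" if "\<And>j. j \<in> {1..n} \<Longrightarrow> \<xi> j = \<eta> j" for \<xi> \<eta>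
      unfolding H_def F_def
      using that by (intro arg_cong2[of _ _ _ _ "(*)"] poly_eval_cong[OF f] vandermonde_sq_cong prod.cong) auto
    define \<Psi> where "\<Psi> l = H (\<lambda>j. nd (l j)) * (\<Prod>j=1..n. wt (l j))" for l
    have "poly_function n (\<lambda>_. nat D + 2 * (n - 1)) F"
      unfolding F_def by (intro poly_function_mult poly_function_poly_eval[OF f] poly_function_vandermonde_sq)
    then have "(LINT \<xi>:({1..n} \<rightarrow>\<^sub>E {0..pi})|(\<Pi>\<^sub>M j\<in>{1..n}. lborel). H \<xi>) =
        (2 * of_real pi) ^ n * (\<Sum>l\<in>{1..n} \<rightarrow>\<^sub>E {..<m + n}. \<Psi> l)"
      unfolding H_def \<Psi>_def
    proof (rule product_quadrature[THEN conjunct2, OF _ order.refl continuous_on_density])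
      fix k assume "k \<le> nat D + 2 * (n - 1)"
      \<comment> \<open>Here D + 2(n - 1) + d' = 2(m + n - 1) + tp + tm - 1, so D is exactly the
        largest degree that the one-variable rule allows.\<close>
      then have "k + d' < 2 * (m + n - 1) + tp + tm"
        using False assms(1) unfolding D_def by linarith
      then show "((\<lambda>\<theta>. of_real (cos \<theta>) ^ k * density \<theta>) has_integral
           2 * of_real pi * (\<Sum>l<m + n. of_real (cos (nd l)) ^ k * density (nd l) * wt l)) {0..pi}"
        by (rule one_variable_quadrature)
    qed
    also have "(\<Sum>l\<in>{1..n} \<rightarrow>\<^sub>E {..<m + n}. \<Psi> l) = fact n * (\<Sum>\<mu>\<in>index_set m n. \<Psi> (\<lambda>j. \<mu> j + (n - j)))"
    proof (rule sum_symmetric_eq_sum_index_set)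
      fix \<sigma> and l :: "nat \<Rightarrow> nat" assume \<sigma>: "\<sigma> permutes {1..n}"
      have prod: "(\<Prod>j=1..n. g (l (\<sigma> j))) = (\<Prod>j=1..n. g (l j))" for g :: "nat \<Rightarrow> complex"
        using prod.permute[OF \<sigma>, of "\<lambda>j. g (l j)"] by (simp add: o_def)
      show "\<Psi> (\<lambda>j. l (\<sigma> j)) = \<Psi> l"
        unfolding \<Psi>_def H_def F_def prod[of wt] prod[of "\<lambda>i. density (nd i)"]
          poly_eval_permute[OF f \<sigma>, of "\<lambda>j. of_real (cos (nd (l j)))"]
          vandermonde_sq_permute[OF \<sigma>, of "\<lambda>j. of_real (cos (nd (l j)))"] ..
    next
      fix l l' :: "nat \<Rightarrow> nat" assume "\<And>j. j \<in> {1..n} \<Longrightarrow> l j = l' j"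
      then show "\<Psi> l = \<Psi> l'"
        unfolding \<Psi>_def by (intro arg_cong2[of _ _ _ _ "(*)"] H_cong prod.cong) auto
    next
      fix l :: "nat \<Rightarrow> nat" assume "\<not> inj_on l {1..n}"
      then have "\<not> inj_on (\<lambda>j. complex_of_real (cos (nd (l j)))) {1..n}"
        unfolding inj_on_def by metis
      then show "\<Psi> l = 0" by (simp add: \<Psi>_def H_def F_def vandermonde_sq_eq_0)
    qed
    also have "(\<Sum>\<mu>\<in>index_set m n. \<Psi> (\<lambda>j. \<mu> j + (n - j))) =
        (\<Sum>\<mu>\<in>index_set m n. H (multi_node m n ep em d a tp tm d' a' \<mu>) * multi_weight m n ep em d a tp tm d' a' \<mu>)"
      unfolding \<Psi>_def multi_weight_def
      by (intro sum.cong refl arg_cong2[of _ _ _ _ "(*)"] H_cong) (simp add: multi_node_def)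
    finally show ?thesis unfolding R by simp
  qed
qed

end
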